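(* Let ${\cal F}=\{F_i \mid i\in I\}$ be a set of types and let $\approx$ be the congruence on types generated by ${\cal F}$ (i.e. the least congruence with $X_i\approx F_i$ for all $i\in I$). If $\approx$ is good, then the system ${\cal S}^{\rightarrow\wedge\vee}_{\approx}$ is strongly normalizing: whenever $\Gamma\vdash M:A$ is derivable in ${\cal S}^{\rightarrow\wedge\vee}_{\approx}$, there is no infinite reduction sequence $M\triangleright M_1\triangleright M_2\triangleright\cdots$.
   Context: Let ${\cal V}$ (term variables) and ${\cal W}$ ($\mu$-variables) be disjoint infinite sets. Terms $M$ and eliminators $\varepsilon$: $M ::= x \mid \lambda x.M \mid (M\;\varepsilon) \mid \langle M,M\rangle \mid \omega_1 M \mid \omega_2 M \mid \mu\alpha.M \mid (\alpha\; M)$, $\varepsilon ::= M \mid \pi_1 \mid \pi_2 \mid [x_1.M, x_2.M]$ ($\lambda x$, $\mu\alpha$, and $x_i$ in $[x_1.N_1,x_2.N_2]$ bind). $M[(\alpha\;L):=(\alpha\;(L\;\varepsilon))]$ replaces (recursively) every subterm $(\alpha\;L)$ of $M$ by $(\alpha\;(L\;\varepsilon))$. The reduction $\triangleright$ is the compatible closure of: $(\lambda x.M\;N)\triangleright M[x:=N]$; $(\mu\alpha.M\;\varepsilon)\triangleright \mu\alpha.M[(\alpha\;L):=(\alpha\;(L\;\varepsilon))]$; $(\langle M_1,M_2\rangle\;\pi_i)\triangleright M_i$; $(\omega_i M\;[x_1.N_1,x_2.N_2])\triangleright N_i[x_i:=M]$; $((M\;[x_1.N_1,x_2.N_2])\;\varepsilon)\triangleright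 (M\;[x_1.(N_1\;\varepsilon),x_2.(N_2\;\varepsilon)])$. Types: $A ::= X \mid \bot \mid A\rightarrow A \mid A\wedge A \mid A\vee A$, $X$ ranging over a set ${\cal A}$ of atomic constants which contains a specified subset ${\cal X}=\{X_i\mid i\in I\}$; $\neg A := A\rightarrow\bot$. A congruence is an equivalence relation on types compatible with $\rightarrow,\wedge,\vee$. For $X\in{\cal X}$, sets ${\cal P}^+(X)$, ${\cal P}^-(X)$ are the least sets such that: $X\in{\cal P}^+(X)$; every atomic type $A\in({\cal A}\cup\{\bot\})\setminus\{X\}$ is in ${\cal P}^+(X)\cap{\cal P}^-(X)$; if $A\in{\cal P}^-(X)$, $B\in{\cal P}^+(X)$ then $A\rightarrow B\in{\cal P}^+(X)$ and $B\rightarrow A\in{\cal P}^-(X)$; if $A,B\in{\cal P}^+(X)$ then $A\wedge B, A\vee B\in{\cal P}^+(X)$; if $A,B\in{\cal P}^-(X)$ then $A\wedge B,A\vee B\in{\cal P}^-(X)$. The congruence $\approx$ is good if for every $X\in{\cal X}$ and every type $A$ with $X\approx A$, $A\in{\cal P}^+(X)$. Contexts: sets of declarations $x:A$, $\alpha:\neg B$, each variable at most once. Typing rules of ${\cal S}^{\rightarrow\wedge\vee}_{\approx}$: $\Gamma,x:A\vdash x:A$; $\Gamma,x:A\vdash M:B \Rightarrow \Gamma\vdash\lambda x.M:A\rightarrow B$; $\Gamma\vdash M:A\rightarrow B$, $\Gamma\vdash N:A\Rightarrow\Gamma\vdash(M\;N):B$; $\Gamma,\alpha:\neg A\vdash M:A\Rightarrow\Gamma,\alpha:\neg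 A\vdash(\alpha\;M):\bot$; $\Gamma,\alpha:\neg A\vdash M:\bot\Rightarrow\Gamma\vdash\mu\alpha.M:A$; $\Gamma\vdash M:A_1$, $\Gamma\vdash N:A_2\Rightarrow\Gamma\vdash\langle M,N\rangle:A_1\wedge A_2$; $\Gamma\vdash M:A_1\wedge A_2\Rightarrow\Gamma\vdash(M\;\pi_i):A_i$; $\Gamma\vdash M:A_j\Rightarrow\Gamma\vdash\omega_jM:A_1\vee A_2$; $\Gamma\vdash M:A_1\vee A_2$, $\Gamma,x_1:A_1\vdash N_1:C$, $\Gamma,x_2:A_2\vdash N_2:C\Rightarrow\Gamma\vdash(M\;[x_1.N_1,x_2.N_2]):C$; and $\Gamma\vdash M:A$, $A\approx B\Rightarrow\Gamma\vdash M:B$. *)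

theory Defs
  imports Main
begin

section \<open>Terms\<close>

text \<open>
  Terms are taken up to renaming of bound variables and are represented with de Bruijn indices.
  Term variables and \<open>\<mu>\<close>-variables are indexed separately: \<open>Lam\<close> and each branch of \<open>Case\<close> bind
  term index 0, \<open>Mu\<close> binds \<open>\<mu>\<close>-index 0.  \<open>Nam a M\<close> is \<open>(\<alpha> M)\<close>, and
  \<open>Case N1 N2\<close> is the eliminator \<open>[x1.N1, x2.N2]\<close>.
\<close>

datatype trm =
    Var nat
  | Lam trm
  | App trm elim
  | Pair trm trm
  | Inj1 trm
  | Inj2 trm
  | Mu trm
  | Nam nat trm
and elim =
    Arg trm
  | Proj1
  | Proj2
  | Case trm trm

text \<open>Shifting of the free term variables with index at least \<open>k\<close>.\<close>

primrec lift :: "nat \<Rightarrow> trm \<Rightarrow> trm" and lift_elim :: "nat \<Rightarrow> elim \<Rightarrow> elim" where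
  "lift k (Var i) = Var (if i < k then i else Suc i)"
| "lift k (Lam M) = Lam (lift (Suc k) M)"
| "lift k (App M e) = App (lift k M) (lift_elim k e)"
| "lift k (Pair M N) = Pair (lift k M) (lift k N)"
| "lift k (Inj1 M) = Inj1 (lift k M)"
| "lift k (Inj2 M) = Inj2 (lift k M)"
| "lift k (Mu M) = Mu (lift k M)"
| "lift k (Nam a M) = Nam a (lift k M)"
| "lift_elim k (Arg M) = Arg (lift k M)"
| "lift_elim k Proj1 = Proj1"
| "lift_elim k Proj2 = Proj2"
| "lift_elim k (Case N1 N2) = Case (lift (Suc k) N1) (lift (Suc k) N2)"

text \<open>Shifting of the free \<open>\<mu>\<close>-variables with index at least \<open>k\<close>.\<close>

primrec mlift :: "nat \<Rightarrow> trm \<Rightarrow> trm" and mlift_elim :: "nat \<Rightarrow> elim \<Rightarrow> elim" where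
  "mlift k (Var i) = Var i"
| "mlift k (Lam M) = Lam (mlift k M)"
| "mlift k (App M e) = App (mlift k M) (mlift_elim k e)"
| "mlift k (Pair M N) = Pair (mlift k M) (mlift k N)"
| "mlift k (Inj1 M) = Inj1 (mlift k M)"
| "mlift k (Inj2 M) = Inj2 (mlift k M)"
| "mlift k (Mu M) = Mu (mlift (Suc k) M)"
| "mlift k (Nam a M) = Nam (if a < k then a else Suc a) (mlift k M)"
| "mlift_elim k (Arg M) = Arg (mlift k M)"
| "mlift_elim k Proj1 = Proj1"
| "mlift_elim k Proj2 = Proj2"
| "mlift_elim k (Case N1 N2) = Case (mlift k N1) (mlift k N2)"

text \<open>
  \<open>subst M k N\<close> is \<open>M[x := N]\<close> for the term variable \<open>x\<close> with index \<open>k\<close>, whose binder is removed: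
  indices above \<open>k\<close> are decremented.
\<close>

primrec subst :: "trm \<Rightarrow> nat \<Rightarrow> trm \<Rightarrow> trm" and subst_elim :: "elim \<Rightarrow> nat \<Rightarrow> trm \<Rightarrow> elim" where
  "subst (Var i) k N = (if i < k then Var i else if i = k then N else Var (i - 1))"
| "subst (Lam M) k N = Lam (subst M (Suc k) (lift 0 N))"
| "subst (App M e) k N = App (subst M k N) (subst_elim e k N)"
| "subst (Pair M1 M2) k N = Pair (subst M1 k N) (subst M2 k N)"
| "subst (Inj1 M) k N = Inj1 (subst M k N)"
| "subst (Inj2 M) k N = Inj2 (subst M k N)"
| "subst (Mu M) k N = Mu (subst M k (mlift 0 N))"
| "subst (Nam a M) k N = Nam a (subst M k N)"
| "subst_elim (Arg M) k N = Arg (subst M k N)"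
| "subst_elim Proj1 k N = Proj1"
| "subst_elim Proj2 k N = Proj2"
| "subst_elim (Case N1 N2) k N =
     Case (subst N1 (Suc k) (lift 0 N)) (subst N2 (Suc k) (lift 0 N))"

text \<open>
  \<open>msubst M a e\<close> is \<open>M[(\<alpha> L) := (\<alpha> (L \<epsilon>))]\<close>, applied recursively.  The variable \<open>\<alpha>\<close> stays bound
  by the same \<open>\<mu>\<close>, so no index is decremented.
\<close>

primrec msubst :: "trm \<Rightarrow> nat \<Rightarrow> elim \<Rightarrow> trm" and msubst_elim :: "elim \<Rightarrow> nat \<Rightarrow> elim \<Rightarrow> elim" where
  "msubst (Var i) a e = Var i"
| "msubst (Lam M) a e = Lam (msubst M a (lift_elim 0 e))"
| "msubst (App M d) a e = App (msubst M a e) (msubst_elim d a e)"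
| "msubst (Pair M N) a e = Pair (msubst M a e) (msubst N a e)"
| "msubst (Inj1 M) a e = Inj1 (msubst M a e)"
| "msubst (Inj2 M) a e = Inj2 (msubst M a e)"
| "msubst (Mu M) a e = Mu (msubst M (Suc a) (mlift_elim 0 e))"
| "msubst (Nam b L) a e =
     (if b = a then Nam b (App (msubst L a e) e) else Nam b (msubst L a e))"
| "msubst_elim (Arg M) a e = Arg (msubst M a e)"
| "msubst_elim Proj1 a e = Proj1"
| "msubst_elim Proj2 a e = Proj2"
| "msubst_elim (Case N1 N2) a e =
     Case (msubst N1 a (lift_elim 0 e)) (msubst N2 a (lift_elim 0 e))"


section \<open>Reduction\<close>

inductive red :: "trm \<Rightarrow> trm \<Rightarrow> bool" (infix "\<triangleright>" 50)
  and red_elim :: "elim \<Rightarrow> elim \<Rightarrow> bool" where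
  beta: "App (Lam M) (Arg N) \<triangleright> subst M 0 N"
| mu: "App (Mu M) e \<triangleright> Mu (msubst M 0 (mlift_elim 0 e))"
| proj1: "App (Pair M1 M2) Proj1 \<triangleright> M1"
| proj2: "App (Pair M1 M2) Proj2 \<triangleright> M2"
| case1: "App (Inj1 M) (Case N1 N2) \<triangleright> subst N1 0 M"
| case2: "App (Inj2 M) (Case N1 N2) \<triangleright> subst N2 0 M"
| perm: "App (App M (Case N1 N2)) e \<triangleright>
     App M (Case (App N1 (lift_elim 0 e)) (App N2 (lift_elim 0 e)))"
| Lam: "M \<triangleright> M' \<Longrightarrow> Lam M \<triangleright> Lam M'"
| AppL: "M \<triangleright> M' \<Longrightarrow> App M e \<triangleright> App M' e"
| AppR: "red_elim e e' \<Longrightarrow> App M e \<triangleright> App M e'"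
| PairL: "M \<triangleright> M' \<Longrightarrow> Pair M N \<triangleright> Pair M' N"
| PairR: "N \<triangleright> N' \<Longrightarrow> Pair M N \<triangleright> Pair M N'"
| Inj1: "M \<triangleright> M' \<Longrightarrow> Inj1 M \<triangleright> Inj1 M'"
| Inj2: "M \<triangleright> M' \<Longrightarrow> Inj2 M \<triangleright> Inj2 M'"
| Mu: "M \<triangleright> M' \<Longrightarrow> Mu M \<triangleright> Mu M'"
| Nam: "M \<triangleright> M' \<Longrightarrow> Nam a M \<triangleright> Nam a M'"
| Arg: "M \<triangleright> M' \<Longrightarrow> red_elim (Arg M) (Arg M')"
| CaseL: "N1 \<triangleright> N1' \<Longrightarrow> red_elim (Case N1 N2) (Case N1' N2)"
| CaseR: "N2 \<triangleright> N2' \<Longrightarrow> red_elim (Case N1 N2) (Case N1 N2')"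


section \<open>Types and congruences\<close>

text \<open>The atomic constants are the elements of the type \<open>'a\<close>.\<close>

datatype 'a ty =
    Atom 'a
  | Bot
  | Fun "'a ty" "'a ty"
  | Conj "'a ty" "'a ty"
  | Disj "'a ty" "'a ty"

inductive gen_cong :: "'i set \<Rightarrow> ('i \<Rightarrow> 'a) \<Rightarrow> ('i \<Rightarrow> 'a ty) \<Rightarrow> 'a ty \<Rightarrow> 'a ty \<Rightarrow> bool"
  for I :: "'i set" and X :: "'i \<Rightarrow> 'a" and F :: "'i \<Rightarrow> 'a ty" where
  gen: "i \<in> I \<Longrightarrow> gen_cong I X F (Atom (X i)) (F i)"
| refl: "gen_cong I X F A A"
| sym: "gen_cong I X F A B \<Longrightarrow> gen_cong I X F B A"
| trans: "gen_cong I X F A B \<Longrightarrow> gen_cong I X F B C \<Longrightarrow> gen_cong I X F A C"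
| Fun: "gen_cong I X F A A' \<Longrightarrow> gen_cong I X F B B' \<Longrightarrow> gen_cong I X F (Fun A B) (Fun A' B')"
| Conj: "gen_cong I X F A A' \<Longrightarrow> gen_cong I X F B B' \<Longrightarrow> gen_cong I X F (Conj A B) (Conj A' B')"
| Disj: "gen_cong I X F A A' \<Longrightarrow> gen_cong I X F B B' \<Longrightarrow> gen_cong I X F (Disj A B) (Disj A' B')"

text \<open>\<open>pos X\<close> and \<open>neg X\<close> are the sets \<open>P\<^sup>+(X)\<close> and \<open>P\<^sup>-(X)\<close>; a type can belong to both.\<close>

inductive_set pos :: "'a \<Rightarrow> 'a ty set" and neg :: "'a \<Rightarrow> 'a ty set" for X :: 'a where
  pos_self: "Atom X \<in> pos X"
| pos_Atom: "Y \<noteq> X \<Longrightarrow> Atom Y \<in> pos X"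
| neg_Atom: "Y \<noteq> X \<Longrightarrow> Atom Y \<in> neg X"
| pos_Bot: "Bot \<in> pos X"
| neg_Bot: "Bot \<in> neg X"
| pos_Fun: "A \<in> neg X \<Longrightarrow> B \<in> pos X \<Longrightarrow> Fun A B \<in> pos X"
| neg_Fun: "A \<in> neg X \<Longrightarrow> B \<in> pos X \<Longrightarrow> Fun B A \<in> neg X"
| pos_Conj: "A \<in> pos X \<Longrightarrow> B \<in> pos X \<Longrightarrow> Conj A B \<in> pos X"
| pos_Disj: "A \<in> pos X \<Longrightarrow> B \<in> pos X \<Longrightarrow> Disj A B \<in> pos X"
| neg_Conj: "A \<in> neg X \<Longrightarrow> B \<in> neg X \<Longrightarrow> Conj A B \<in> neg X"
| neg_Disj: "A \<in> neg X \<Longrightarrow> B \<in> neg X \<Longrightarrow> Disj A B \<in> neg X"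

definition good :: "'a set \<Rightarrow> ('a ty \<Rightarrow> 'a ty \<Rightarrow> bool) \<Rightarrow> bool" where
  "good XX R \<longleftrightarrow> (\<forall>X\<in>XX. \<forall>A. R (Atom X) A \<longrightarrow> A \<in> pos X)"


section \<open>Typing\<close>

text \<open>
  A context is split into the declarations \<open>\<Gamma>\<close> of the term variables and \<open>\<Delta>\<close> of the
  \<open>\<mu>\<close>-variables, both partial maps on indices.  \<open>\<mu>\<close>-variables are only ever declared with a negated
  type, and just the type below the negation is stored: \<open>\<Delta> a = Some B\<close> stands for
  \<open>\<alpha> : \<not>B\<close>, where \<open>\<not>B\<close> is \<open>Fun B Bot\<close>.
\<close>

type_synonym 'a ctx = "nat \<Rightarrow> 'a ty option"

text \<open>\<open>ext A \<Gamma>\<close> declares index 0 with \<open>A\<close> and shifts the declarations in \<open>\<Gamma>\<close>.\<close>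

definition ext :: "'a ty \<Rightarrow> 'a ctx \<Rightarrow> 'a ctx" where
  "ext A \<Gamma> = case_nat (Some A) \<Gamma>"

inductive typing :: "('a ty \<Rightarrow> 'a ty \<Rightarrow> bool) \<Rightarrow> 'a ctx \<Rightarrow> 'a ctx \<Rightarrow> trm \<Rightarrow> 'a ty \<Rightarrow> bool"
  for R :: "'a ty \<Rightarrow> 'a ty \<Rightarrow> bool" where
  ax: "\<Gamma> x = Some A \<Longrightarrow> typing R \<Gamma> \<Delta> (Var x) A"
| impI: "typing R (ext A \<Gamma>) \<Delta> M B \<Longrightarrow> typing R \<Gamma> \<Delta> (Lam M) (Fun A B)"
| impE: "typing R \<Gamma> \<Delta> M (Fun A B) \<Longrightarrow> typing R \<Gamma> \<Delta> N A \<Longrightarrow> typing R \<Gamma> \<Delta> (App M (Arg N)) B"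
| botI: "\<Delta> a = Some A \<Longrightarrow> typing R \<Gamma> \<Delta> M A \<Longrightarrow> typing R \<Gamma> \<Delta> (Nam a M) Bot"
| botE: "typing R \<Gamma> (ext A \<Delta>) M Bot \<Longrightarrow> typing R \<Gamma> \<Delta> (Mu M) A"
| conjI: "typing R \<Gamma> \<Delta> M A1 \<Longrightarrow> typing R \<Gamma> \<Delta> N A2 \<Longrightarrow> typing R \<Gamma> \<Delta> (Pair M N) (Conj A1 A2)"
| conjE1: "typing R \<Gamma> \<Delta> M (Conj A1 A2) \<Longrightarrow> typing R \<Gamma> \<Delta> (App M Proj1) A1"
| conjE2: "typing R \<Gamma> \<Delta> M (Conj A1 A2) \<Longrightarrow> typing R \<Gamma> \<Delta> (App M Proj2) A2"
| disjI1: "typing R \<Gamma> \<Delta> M A1 \<Longrightarrow> typing R \<Gamma> \<Delta> (Inj1 M) (Disj A1 A2)"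
| disjI2: "typing R \<Gamma> \<Delta> M A2 \<Longrightarrow> typing R \<Gamma> \<Delta> (Inj2 M) (Disj A1 A2)"
| disjE: "typing R \<Gamma> \<Delta> M (Disj A1 A2) \<Longrightarrow> typing R (ext A1 \<Gamma>) \<Delta> N1 C \<Longrightarrow>
     typing R (ext A2 \<Gamma>) \<Delta> N2 C \<Longrightarrow> typing R \<Gamma> \<Delta> (App M (Case N1 N2)) C"
| conv: "typing R \<Gamma> \<Delta> M A \<Longrightarrow> R A B \<Longrightarrow> typing R \<Gamma> \<Delta> M B"

end

theory Submission
  imports Defs
begin

text \<open>
  The proof is by orthogonality. A type \<open>A\<close> is interpreted by a set of stacks, i.e. lists of
  eliminators, and the reducible terms of type \<open>A\<close> are those that are strongly normalizing against
  all stacks of \<open>A\<close>. A stack \<open>[x1.N1, x2.N2] s\<close> belongs to a disjunction iff each \<open>Ni[P] s\<close> is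
  strongly normalizing for reducible \<open>P\<close>. As the rest \<open>s\<close> of the stack is part of this condition,
  it is not disturbed by permutative conversions, which act inside stacks; likewise \<open>(\<mu>\<alpha>. M) s\<close>
  is strongly normalizing as soon as \<open>s\<close> and \<open>M[(\<alpha> L) := (\<alpha> (L s))]\<close> are.

  A derivation uses only finitely many of the equations \<open>Xi = Fi\<close>, so it remains to interpret the
  \<open>Xi\<close> of a finite subset such that these equations hold. Goodness says that no cycle of the
  dependency graph passes through an odd number of negative positions, so that within a strongly
  connected component the equations are monotone once the order is reversed at suitable atoms; the
  components are solved one after the other with the Knaster-Tarski theorem.
\<close>

section \<open>Simultaneous renaming and substitution\<close>

primrec ren :: "(nat \<Rightarrow> nat) \<Rightarrow> (nat \<Rightarrow> nat) \<Rightarrow> trm \<Rightarrow> trm"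
  and ren_elim :: "(nat \<Rightarrow> nat) \<Rightarrow> (nat \<Rightarrow> nat) \<Rightarrow> elim \<Rightarrow> elim" where
  "ren f g (Var i) = Var (f i)"
| "ren f g (Lam M) = Lam (ren (case_nat 0 (Suc \<circ> f)) g M)"
| "ren f g (App M e) = App (ren f g M) (ren_elim f g e)"
| "ren f g (Pair M N) = Pair (ren f g M) (ren f g N)"
| "ren f g (Inj1 M) = Inj1 (ren f g M)"
| "ren f g (Inj2 M) = Inj2 (ren f g M)"
| "ren f g (Mu M) = Mu (ren f (case_nat 0 (Suc \<circ> g)) M)"
| "ren f g (Nam a M) = Nam (g a) (ren f g M)"
| "ren_elim f g (Arg M) = Arg (ren f g M)"
| "ren_elim f g Proj1 = Proj1"
| "ren_elim f g Proj2 = Proj2"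
| "ren_elim f g (Case N1 N2) =
     Case (ren (case_nat 0 (Suc \<circ> f)) g N1) (ren (case_nat 0 (Suc \<circ> f)) g N2)"

abbreviation apps :: "trm \<Rightarrow> elim list \<Rightarrow> trm" where
  "apps \<equiv> foldl App"

text \<open>Whole stacks instead of single eliminators make these substitutions closed under
  composition.\<close>

type_synonym msub = "nat \<Rightarrow> nat \<times> elim list"

definition lift_sub :: "(nat \<Rightarrow> trm) \<Rightarrow> nat \<Rightarrow> trm" where
  "lift_sub \<sigma> = case_nat (Var 0) (\<lambda>i. ren Suc id (\<sigma> i))"

definition lift_msub :: "msub \<Rightarrow> msub" where
  "lift_msub \<rho> = (\<lambda>b. map_prod id (map (ren_elim Suc id)) (\<rho> b))"

definition mlift_sub :: "(nat \<Rightarrow> trm) \<Rightarrow> nat \<Rightarrow> trm" where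
  "mlift_sub \<sigma> = (\<lambda>i. ren id Suc (\<sigma> i))"

text \<open>The newly bound \<mu>-variable keeps its name and receives the empty stack, so the terms
  it names are not extended.\<close>

definition mlift_msub :: "msub \<Rightarrow> msub" where
  "mlift_msub \<rho> = case_nat (0, []) (\<lambda>b. map_prod Suc (map (ren_elim id Suc)) (\<rho> b))"

text \<open>
  If \<open>\<rho> b = (c, s)\<close>, then \<open>Nam b L\<close> becomes \<open>L\<close> applied to the stack \<open>s\<close> under the name \<open>c\<close>:
  unlike \<open>msubst\<close>, \<open>sub\<close> also renames.
\<close>

primrec sub :: "(nat \<Rightarrow> trm) \<Rightarrow> msub \<Rightarrow> trm \<Rightarrow> trm"
  and sub_elim :: "(nat \<Rightarrow> trm) \<Rightarrow> msub \<Rightarrow> elim \<Rightarrow> elim" where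
  "sub \<sigma> \<rho> (Var i) = \<sigma> i"
| "sub \<sigma> \<rho> (Lam M) = Lam (sub (lift_sub \<sigma>) (lift_msub \<rho>) M)"
| "sub \<sigma> \<rho> (App M e) = App (sub \<sigma> \<rho> M) (sub_elim \<sigma> \<rho> e)"
| "sub \<sigma> \<rho> (Pair M N) = Pair (sub \<sigma> \<rho> M) (sub \<sigma> \<rho> N)"
| "sub \<sigma> \<rho> (Inj1 M) = Inj1 (sub \<sigma> \<rho> M)"
| "sub \<sigma> \<rho> (Inj2 M) = Inj2 (sub \<sigma> \<rho> M)"
| "sub \<sigma> \<rho> (Mu M) = Mu (sub (mlift_sub \<sigma>) (mlift_msub \<rho>) M)"
| "sub \<sigma> \<rho> (Nam a M) = Nam (fst (\<rho> a)) (apps (sub \<sigma> \<rho> M) (snd (\<rho> a)))"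
| "sub_elim \<sigma> \<rho> (Arg M) = Arg (sub \<sigma> \<rho> M)"
| "sub_elim \<sigma> \<rho> Proj1 = Proj1"
| "sub_elim \<sigma> \<rho> Proj2 = Proj2"
| "sub_elim \<sigma> \<rho> (Case N1 N2) =
     Case (sub (lift_sub \<sigma>) (lift_msub \<rho>) N1) (sub (lift_sub \<sigma>) (lift_msub \<rho>) N2)"

section \<open>Composition of renamings and substitutions\<close>

lemma ren_apps: "ren f g (apps M s) = apps (ren f g M) (map (ren_elim f g) s)"
  by (induction s arbitrary: M) auto

lemma sub_apps: "sub \<sigma> \<rho> (apps M s) = apps (sub \<sigma> \<rho> M) (map (sub_elim \<sigma> \<rho>) s)"
  by (induction s arbitrary: M) auto

lemma case_nat_comp: "case_nat 0 (Suc \<circ> f) \<circ> case_nat 0 (Suc \<circ> g) = case_nat 0 (Suc \<circ> (f \<circ> g))"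
  by (auto simp: fun_eq_iff split: nat.splits)

lemma ren_ren:
  "ren f g (ren f' g' M) = ren (f \<circ> f') (g \<circ> g') M"
  "ren_elim f g (ren_elim f' g' e) = ren_elim (f \<circ> f') (g \<circ> g') e"
  by (induction M and e arbitrary: f g f' g' and f g f' g' rule: trm.induct elim.induct)
    (simp_all add: case_nat_comp del: comp_apply, simp_all)

lemma case_nat_id: "case_nat 0 Suc = id"
  by (auto simp: fun_eq_iff split: nat.splits)

lemma lift_sub_ren: "lift_sub \<sigma> \<circ> case_nat 0 (Suc \<circ> f) = lift_sub (\<sigma> \<circ> f)"
  by (auto simp: fun_eq_iff lift_sub_def split: nat.splits)

lemma lift_msub_ren: "lift_msub \<rho> \<circ> g = lift_msub (\<rho> \<circ> g)"
  by (auto simp: fun_eq_iff lift_msub_def)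

lemma mlift_sub_ren: "mlift_sub \<sigma> \<circ> f = mlift_sub (\<sigma> \<circ> f)"
  by (auto simp: fun_eq_iff mlift_sub_def)

lemma mlift_msub_ren: "mlift_msub \<rho> \<circ> case_nat 0 (Suc \<circ> g) = mlift_msub (\<rho> \<circ> g)"
  by (auto simp: fun_eq_iff mlift_msub_def split: nat.splits)

lemma sub_ren:
  "sub \<sigma> \<rho> (ren f g M) = sub (\<sigma> \<circ> f) (\<rho> \<circ> g) M"
  "sub_elim \<sigma> \<rho> (ren_elim f g e) = sub_elim (\<sigma> \<circ> f) (\<rho> \<circ> g) e"
  by (induction M and e arbitrary: f g \<sigma> \<rho> and f g \<sigma> \<rho> rule: trm.induct elim.induct)
    (simp_all add: lift_sub_ren lift_msub_ren mlift_sub_ren mlift_msub_ren del: comp_apply, simp_all)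

definition ren_msub :: "(nat \<Rightarrow> nat) \<Rightarrow> (nat \<Rightarrow> nat) \<Rightarrow> msub \<Rightarrow> msub" where
  "ren_msub f g \<rho> = (\<lambda>b. map_prod g (map (ren_elim f g)) (\<rho> b))"

lemma ren_lift_sub: "ren (case_nat 0 (Suc \<circ> f)) g \<circ> lift_sub \<sigma> = lift_sub (ren f g \<circ> \<sigma>)"
  by (auto simp: fun_eq_iff lift_sub_def ren_ren intro!: arg_cong2[where f="\<lambda>f g. ren f g _"] split: nat.splits)

lemma ren_lift_msub:
  "ren_msub (case_nat 0 (Suc \<circ> f)) g (lift_msub \<rho>) = lift_msub (ren_msub f g \<rho>)"
  by (auto simp: fun_eq_iff lift_msub_def ren_msub_def ren_ren prod.map_comp
      intro!: arg_cong2[where f="\<lambda>f g. ren_elim f g _"] prod.map_cong)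

lemma ren_mlift_sub: "ren f (case_nat 0 (Suc \<circ> g)) \<circ> mlift_sub \<sigma> = mlift_sub (ren f g \<circ> \<sigma>)"
  by (auto simp: fun_eq_iff mlift_sub_def ren_ren intro!: arg_cong2[where f="\<lambda>f g. ren f g _"])

lemma ren_mlift_msub:
  "ren_msub f (case_nat 0 (Suc \<circ> g)) (mlift_msub \<rho>) = mlift_msub (ren_msub f g \<rho>)"
  by (auto simp: fun_eq_iff mlift_msub_def ren_msub_def ren_ren prod.map_comp split: nat.splits
      intro!: arg_cong2[where f="\<lambda>f g. ren_elim f g _"] prod.map_cong)

lemma ren_sub:
  "ren f g (sub \<sigma> \<rho> M) = sub (ren f g \<circ> \<sigma>) (ren_msub f g \<rho>) M"
  "ren_elim f g (sub_elim \<sigma> \<rho> e) = sub_elim (ren f g \<circ> \<sigma>) (ren_msub f g \<rho>) e"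
proof (induction M and e arbitrary: f g \<sigma> \<rho> and f g \<sigma> \<rho> rule: trm.induct elim.induct)
  case (Nam a M)
  then show ?case by (simp add: ren_apps) (simp add: ren_msub_def)
qed (simp_all add: ren_lift_sub ren_lift_msub ren_mlift_sub ren_mlift_msub del: comp_apply, simp_all)

text \<open>The name introduced by the inner substitution is itself subject to the outer one, so the
  outer stack is appended behind the substituted inner stack.\<close>

definition sub_msub :: "(nat \<Rightarrow> trm) \<Rightarrow> msub \<Rightarrow> msub \<Rightarrow> msub" where
  "sub_msub \<sigma> \<rho> \<rho>' = (\<lambda>b. (fst (\<rho> (fst (\<rho>' b))),
     map (sub_elim \<sigma> \<rho>) (snd (\<rho>' b)) @ snd (\<rho> (fst (\<rho>' b)))))"

lemma lift_sub_Suc: "lift_sub \<sigma> \<circ> Suc = ren Suc id \<circ> \<sigma>" "lift_msub \<rho> \<circ> id = ren_msub Suc id \<rho>"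
  by (auto simp: fun_eq_iff lift_sub_def lift_msub_def ren_msub_def)

lemma sub_lift_sub: "sub (lift_sub \<sigma>) (lift_msub \<rho>) \<circ> lift_sub \<sigma>' = lift_sub (sub \<sigma> \<rho> \<circ> \<sigma>')"
proof -
  have "sub (lift_sub \<sigma>) (lift_msub \<rho>) (ren Suc id M) = ren Suc id (sub \<sigma> \<rho> M)" for M
    by (simp only: sub_ren ren_sub lift_sub_Suc)
  then show ?thesis
    by (auto simp: fun_eq_iff lift_sub_def[of \<sigma>'] lift_sub_def[of "sub \<sigma> \<rho> \<circ> \<sigma>'"] split: nat.splits)
      (simp add: lift_sub_def)
qed

lemma sub_lift_msub:
  "sub_msub (lift_sub \<sigma>) (lift_msub \<rho>) (lift_msub \<rho>') = lift_msub (sub_msub \<sigma> \<rho> \<rho>')"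
proof -
  have "sub_elim (lift_sub \<sigma>) (lift_msub \<rho>) (ren_elim Suc id e)
      = ren_elim Suc id (sub_elim \<sigma> \<rho> e)" for e
    by (simp only: sub_ren ren_sub lift_sub_Suc)
  then show ?thesis
    by (auto simp: fun_eq_iff sub_msub_def lift_msub_def)
qed

lemma mlift_sub_id: "mlift_sub \<sigma> \<circ> id = ren id Suc \<circ> \<sigma>" "mlift_msub \<rho> \<circ> Suc = ren_msub id Suc \<rho>"
  by (auto simp: fun_eq_iff mlift_sub_def mlift_msub_def ren_msub_def)

lemma sub_mlift_sub: "sub (mlift_sub \<sigma>) (mlift_msub \<rho>) \<circ> mlift_sub \<sigma>' = mlift_sub (sub \<sigma> \<rho> \<circ> \<sigma>')"
  unfolding mlift_sub_def[of \<sigma>'] mlift_sub_def[of "sub \<sigma> \<rho> \<circ> \<sigma>'"]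
  by (simp only: fun_eq_iff comp_apply sub_ren ren_sub mlift_sub_id) simp

lemma sub_mlift_msub:
  "sub_msub (mlift_sub \<sigma>) (mlift_msub \<rho>) (mlift_msub \<rho>') = mlift_msub (sub_msub \<sigma> \<rho> \<rho>')"
proof -
  have "sub_elim (mlift_sub \<sigma>) (mlift_msub \<rho>) (ren_elim id Suc e)
      = ren_elim id Suc (sub_elim \<sigma> \<rho> e)" for e
    by (simp only: sub_ren ren_sub mlift_sub_id)
  then show ?thesis
    by (auto simp: fun_eq_iff sub_msub_def mlift_msub_def split: nat.splits)
qed

text \<open>Under a binder the substituted values are shifted, so composing substitutions requires
  commuting them with renamings first. Hence the order of the laws: \<open>ren_ren\<close> prepares
  \<open>ren_sub\<close>, and \<open>sub_ren\<close> with \<open>ren_sub\<close> prepares this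
  one.\<close>

lemma sub_sub:
  "sub \<sigma> \<rho> (sub \<sigma>' \<rho>' M) = sub (sub \<sigma> \<rho> \<circ> \<sigma>') (sub_msub \<sigma> \<rho> \<rho>') M"
  "sub_elim \<sigma> \<rho> (sub_elim \<sigma>' \<rho>' e) = sub_elim (sub \<sigma> \<rho> \<circ> \<sigma>') (sub_msub \<sigma> \<rho> \<rho>') e"
proof (induction M and e arbitrary: \<sigma> \<rho> \<sigma>' \<rho>' and \<sigma> \<rho> \<sigma>' \<rho>' rule: trm.induct elim.induct)
  case (Nam a M)
  then show ?case by (simp add: sub_apps) (simp add: sub_msub_def)
qed (simp_all add: sub_lift_sub sub_lift_msub sub_mlift_sub sub_mlift_msub del: comp_apply, simp_all)

section \<open>The de Bruijn operations as instances of renaming and substitution\<close>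

definition id_msub :: msub where
  "id_msub = (\<lambda>b. (b, []))"

lemma id_msub_simps [simp]: "fst (id_msub b) = b" "snd (id_msub b) = []"
  by (simp_all add: id_msub_def)

lemma lift_id: "lift_sub Var = Var" "lift_msub id_msub = id_msub"
  "mlift_sub Var = Var" "mlift_msub id_msub = id_msub"
  by (auto simp: fun_eq_iff lift_sub_def lift_msub_def mlift_sub_def mlift_msub_def id_msub_def
      split: nat.splits)

lemma sub_id: "sub Var id_msub M = M" "sub_elim Var id_msub e = e"
  by (induction M and e rule: trm.induct elim.induct) (simp_all add: lift_id)

lemma ren_eq_sub:
  "ren f g M = sub (Var \<circ> f) (id_msub \<circ> g) M"
  "ren_elim f g e = sub_elim (Var \<circ> f) (id_msub \<circ> g) e"
  using sub_ren[of Var id_msub f g] by (simp_all add: sub_id)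

lemma lift_eq_ren:
  "lift k M = ren (\<lambda>i. if i < k then i else Suc i) id M"
  "lift_elim k e = ren_elim (\<lambda>i. if i < k then i else Suc i) id e"
  by (induction M and e arbitrary: k and k rule: trm.induct elim.induct)
    (auto simp: fun_eq_iff case_nat_id intro!: arg_cong2[where f="\<lambda>f g. ren f g _"] split: nat.splits)

lemma mlift_eq_ren:
  "mlift k M = ren id (\<lambda>i. if i < k then i else Suc i) M"
  "mlift_elim k e = ren_elim id (\<lambda>i. if i < k then i else Suc i) e"
  by (induction M and e arbitrary: k and k rule: trm.induct elim.induct)
    (auto simp: fun_eq_iff case_nat_id intro!: arg_cong2[where f="\<lambda>f g. ren f g _"] split: nat.splits)

lemma lift0: "lift 0 = ren Suc id" "lift_elim 0 = ren_elim Suc id"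
  "mlift 0 = ren id Suc" "mlift_elim 0 = ren_elim id Suc"
  by (auto simp: fun_eq_iff lift_eq_ren mlift_eq_ren)

text \<open>The index is general because the induction passes under binders; reduction only uses
  index 0.\<close>

lemma subst_eq_sub_index:
  "subst M k N = sub (\<lambda>i. if i < k then Var i else if i = k then N else Var (i - 1)) id_msub M"
  "subst_elim e k N = sub_elim (\<lambda>i. if i < k then Var i else if i = k then N else Var (i - 1)) id_msub e"
  by (induction M and e arbitrary: k N and k N rule: trm.induct elim.induct)
    (auto simp: lift_id fun_eq_iff lift0 lift_sub_def mlift_sub_def
    intro!: arg_cong2[where f="\<lambda>f g. sub f g _"] split: nat.splits)

lemma subst_eq_sub: "subst M 0 N = sub (case_nat N Var) id_msub M"
  by (auto simp: subst_eq_sub_index fun_eq_iff intro!: arg_cong2[where f="\<lambda>f g. sub f g _"] split: nat.splits)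

lemma msubst_eq_sub:
  "msubst M a e = sub Var (\<lambda>b. (b, if b = a then [e] else [])) M"
  "msubst_elim d a e = sub_elim Var (\<lambda>b. (b, if b = a then [e] else [])) d"
  by (induction M and d arbitrary: a e and a e rule: trm.induct elim.induct)
    (auto simp: lift_id fun_eq_iff lift0 lift_msub_def mlift_msub_def
    intro!: arg_cong2[where f="\<lambda>f g. sub f g _"] split: nat.splits)

section \<open>Reduction and substitution\<close>

lemma case_nat_sub_lift: "sub (case_nat N \<sigma>) \<rho> (ren Suc id M) = sub \<sigma> \<rho> M"
  "sub_elim (case_nat N \<sigma>) \<rho> (ren_elim Suc id e) = sub_elim \<sigma> \<rho> e"
  by (simp_all add: sub_ren comp_def)

lemma case_nat_sub_mlift: "sub \<sigma> (case_nat p \<rho>) (ren id Suc M) = sub \<sigma> \<rho> M"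
  "sub_elim \<sigma> (case_nat p \<rho>) (ren_elim id Suc e) = sub_elim \<sigma> \<rho> e"
  by (simp_all add: sub_ren comp_def)

text \<open>Contracting a redex after a substitution amounts to one substitution that also covers
  the bound variable. This is the form in which induction hypotheses apply in
  \<open>adequacy\<close>.\<close>

lemma subst_lift_sub:
  "subst (sub (lift_sub \<sigma>) (lift_msub \<rho>) M) 0 N = sub (case_nat N \<sigma>) \<rho> M"
proof -
  have "sub (case_nat N Var) id_msub \<circ> lift_sub \<sigma> = case_nat N \<sigma>"
    by (auto simp: fun_eq_iff lift_sub_def case_nat_sub_lift sub_id split: nat.splits)
  moreover have "sub_msub (case_nat N Var) id_msub (lift_msub \<rho>) = \<rho>"
    by (auto simp: fun_eq_iff sub_msub_def lift_msub_def case_nat_sub_lift sub_id comp_def)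
  ultimately show ?thesis by (simp add: subst_eq_sub sub_sub)
qed

lemma sub_subst:
  "sub \<sigma> \<rho> (subst M 0 N) = subst (sub (lift_sub \<sigma>) (lift_msub \<rho>) M) 0 (sub \<sigma> \<rho> N)"
proof -
  have "sub \<sigma> \<rho> \<circ> case_nat N Var = case_nat (sub \<sigma> \<rho> N) \<sigma>"
    by (auto simp: fun_eq_iff split: nat.splits)
  moreover have "sub_msub \<sigma> \<rho> id_msub = \<rho>"
    by (auto simp: fun_eq_iff sub_msub_def)
  ultimately show ?thesis unfolding subst_lift_sub by (simp add: subst_eq_sub sub_sub)
qed

text \<open>Opens the body of a \<open>Mu\<close>: the bound variable becomes the free name
  \<open>c\<close>, and everything it names receives the whole stack \<open>s\<close>.\<close>

abbreviation minst :: "nat \<Rightarrow> elim list \<Rightarrow> trm \<Rightarrow> trm" where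
  "minst c s \<equiv> sub Var (case_nat (c, s) id_msub)"

lemma minst_mlift_sub:
  "minst c s (sub (mlift_sub \<sigma>) (mlift_msub \<rho>) M) = sub \<sigma> (case_nat (c, s) \<rho>) M"
proof -
  have "minst c s \<circ> mlift_sub \<sigma> = \<sigma>"
    by (auto simp: fun_eq_iff mlift_sub_def case_nat_sub_mlift sub_id)
  moreover have "sub_msub Var (case_nat (c, s) id_msub) (mlift_msub \<rho>) = case_nat (c, s) \<rho>"
    by (auto simp: fun_eq_iff sub_msub_def mlift_msub_def case_nat_sub_mlift sub_id comp_def split: nat.splits)
  ultimately show ?thesis by (simp add: sub_sub)
qed

text \<open>A \<open>mu\<close> step moves one eliminator from the stack into the body. Once the
  rest of the stack is passed as well, the result is the same as passing everything at once.\<close>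

lemma minst_msubst: "minst c s (msubst M 0 (mlift_elim 0 e)) = minst c (e # s) M"
proof -
  have "minst c s \<circ> Var = Var"
    by (auto simp: fun_eq_iff)
  moreover have "sub_msub Var (case_nat (c, s) id_msub) (\<lambda>b. (b, if b = 0 then [ren_elim id Suc e] else []))
    = case_nat (c, e # s) id_msub"
    by (auto simp: fun_eq_iff sub_msub_def case_nat_sub_mlift sub_id split: nat.splits)
  ultimately show ?thesis by (simp add: msubst_eq_sub sub_sub lift0)
qed

lemma sub_msubst:
  "sub (mlift_sub \<sigma>) (mlift_msub \<rho>) (msubst M 0 (mlift_elim 0 e)) =
   msubst (sub (mlift_sub \<sigma>) (mlift_msub \<rho>) M) 0 (mlift_elim 0 (sub_elim \<sigma> \<rho> e))"
proof -
  let ?e = "\<lambda>e b. (b, if b = 0 then [ren_elim id Suc e] else [])"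
  \<comment> \<open>The substitution \<open>?e d\<close> acts nontrivially only on index 0, which
    does not occur free in \<mu>-shifted terms.\<close>
  have "?e d \<circ> Suc = id_msub \<circ> Suc" for d
    by (auto simp: fun_eq_iff id_msub_def)
  then have e: "sub Var (?e d) (ren id Suc N) = ren id Suc N"
    "sub_elim Var (?e d) (ren_elim id Suc d') = ren_elim id Suc d'" for d N d'
    by (simp_all only: sub_ren) (simp_all add: ren_eq_sub)
  have \<sigma>: "sub (mlift_sub \<sigma>) (mlift_msub \<rho>) \<circ> Var = sub Var (?e (sub_elim \<sigma> \<rho> e)) \<circ> mlift_sub \<sigma>"
    by (auto simp: fun_eq_iff mlift_sub_def e)
  moreover have "sub_elim (mlift_sub \<sigma>) (mlift_msub \<rho>) (ren_elim id Suc e)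
      = ren_elim id Suc (sub_elim \<sigma> \<rho> e)"
    by (simp only: sub_ren ren_sub mlift_sub_id)
  ultimately have "sub_msub (mlift_sub \<sigma>) (mlift_msub \<rho>) (?e e)
      = sub_msub Var (?e (sub_elim \<sigma> \<rho> e)) (mlift_msub \<rho>)"
    by (auto simp: fun_eq_iff sub_msub_def mlift_msub_def e split: nat.splits)
  then show ?thesis
    using \<sigma> by (simp add: msubst_eq_sub sub_sub lift0)
qed

text \<open>Substitution preserves each single step. Hence an instance of a term is at least as hard
  to normalize as the term itself, which \<open>SN_sub\<close> exploits.\<close>

lemma red_sub:
  "M \<triangleright> M' \<Longrightarrow> sub \<sigma> \<rho> M \<triangleright> sub \<sigma> \<rho> M'"
  "red_elim e e' \<Longrightarrow> red_elim (sub_elim \<sigma> \<rho> e) (sub_elim \<sigma> \<rho> e')"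
proof (induction arbitrary: \<sigma> \<rho> and \<sigma> \<rho> rule: red_red_elim.inducts)
  case (perm M N1 N2 e)
  have "sub_elim (lift_sub \<sigma>) (lift_msub \<rho>) (lift_elim 0 e) = lift_elim 0 (sub_elim \<sigma> \<rho> e)"
    by (simp only: lift0 sub_ren ren_sub lift_sub_Suc)
  then show ?case by (simp add: red_red_elim.perm)
next
  case (Nam M M' a)
  have "N \<triangleright> N' \<Longrightarrow> apps N s \<triangleright> apps N' s" for N N' s
    by (induction s arbitrary: N N') (auto intro: red_red_elim.AppL)
  with Nam show ?case by (auto intro: red_red_elim.Nam)
qed (auto simp: sub_subst sub_msubst intro: red_red_elim.intros)

text \<open>Including the permutation of a \<open>Case\<close> with its successor makes permutative
  conversions between eliminators of \<open>apps M s\<close> reductions of \<open>s\<close> alone,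
  whatever the head \<open>M\<close>.\<close>

inductive sred :: "elim list \<Rightarrow> elim list \<Rightarrow> bool" where
  sred_hd: "red_elim e e' \<Longrightarrow> sred (e # s) (e' # s)"
| sred_tl: "sred s s' \<Longrightarrow> sred (e # s) (e # s')"
| sred_perm: "sred (Case N1 N2 # e # s)
     (Case (App N1 (lift_elim 0 e)) (App N2 (lift_elim 0 e)) # s)"

lemma red_apps: "M \<triangleright> M' \<Longrightarrow> apps M s \<triangleright> apps M' s"
  by (induction s arbitrary: M M') (auto intro: AppL)

lemma sred_apps: "sred s s' \<Longrightarrow> apps M s \<triangleright> apps M s'"
  by (induction arbitrary: M rule: sred.induct) (auto intro: red_apps red_red_elim.intros)

lemma sred_append: "sred s s' \<Longrightarrow> sred (s @ t) (s' @ t)"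
  by (induction rule: sred.induct) (auto intro: sred.intros)

lemma sred_append_left: "sred s s' \<Longrightarrow> sred (t @ s) (t @ s')"
  by (induction t) (auto intro: sred.intros)

lemma sred_sub: "sred s s' \<Longrightarrow> sred (map (sub_elim \<sigma> \<rho>) s) (map (sub_elim \<sigma> \<rho>) s')"
proof (induction rule: sred.induct)
  case (sred_perm N1 N2 e s)
  have "sub_elim (lift_sub \<sigma>) (lift_msub \<rho>) (lift_elim 0 e) = lift_elim 0 (sub_elim \<sigma> \<rho> e)"
    by (simp only: lift0 sub_ren ren_sub lift_sub_Suc)
  then show ?case by (simp add: sred.sred_perm)
qed (auto intro: sred.intros red_sub)

section \<open>Many-step reduction\<close>

abbreviation reds (infix "\<triangleright>*" 50) where "reds \<equiv> red\<^sup>*\<^sup>*"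

lemma rtranclp_map:
  assumes "r\<^sup>*\<^sup>* x y" "\<And>x y. r x y \<Longrightarrow> q (f x) (f y)"
  shows "q\<^sup>*\<^sup>* (f x) (f y)"
  using assms(1) by (induction rule: rtranclp_induct) (auto intro: assms(2) rtranclp.rtrancl_into_rtrancl)

lemma reds_sub_term: "M \<triangleright>* M' \<Longrightarrow> sub \<sigma> \<rho> M \<triangleright>* sub \<sigma> \<rho> M'"
  by (erule rtranclp_map) (rule red_sub)

lemma reds_apps:
  assumes "M \<triangleright>* M'" "sred\<^sup>*\<^sup>* s s'"
  shows "apps M s \<triangleright>* apps M' s'"
proof -
  have "apps M s \<triangleright>* apps M' s" using assms(1) by (rule rtranclp_map) (rule red_apps)
  moreover have "apps M' s \<triangleright>* apps M' s'" using assms(2) by (rule rtranclp_map) (rule sred_apps)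
  ultimately show ?thesis by (rule rtranclp_trans)
qed

definition msub_reds :: "msub \<Rightarrow> msub \<Rightarrow> bool" where
  "msub_reds \<rho> \<rho>' \<longleftrightarrow> (\<forall>b. fst (\<rho> b) = fst (\<rho>' b) \<and> sred\<^sup>*\<^sup>* (snd (\<rho> b)) (snd (\<rho>' b)))"

lemma reds_cong:
  "M \<triangleright>* M' \<Longrightarrow> Lam M \<triangleright>* Lam M'"
  "M \<triangleright>* M' \<Longrightarrow> Inj1 M \<triangleright>* Inj1 M'"
  "M \<triangleright>* M' \<Longrightarrow> Inj2 M \<triangleright>* Inj2 M'"
  "M \<triangleright>* M' \<Longrightarrow> Mu M \<triangleright>* Mu M'"
  "M \<triangleright>* M' \<Longrightarrow> Nam a M \<triangleright>* Nam a M'"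
  "M \<triangleright>* M' \<Longrightarrow> red_elim\<^sup>*\<^sup>* (Arg M) (Arg M')"
  by (erule rtranclp_map, rule red_red_elim.intros, assumption)+

lemma reds_cong2:
  assumes "M \<triangleright>* M'"
  shows "N \<triangleright>* N' \<Longrightarrow> Pair M N \<triangleright>* Pair M' N'"
    "red_elim\<^sup>*\<^sup>* e e' \<Longrightarrow> App M e \<triangleright>* App M' e'"
    "N \<triangleright>* N' \<Longrightarrow> red_elim\<^sup>*\<^sup>* (Case M N) (Case M' N')"
proof -
  have "Pair M N \<triangleright>* Pair M' N" "App M e \<triangleright>* App M' e" "red_elim\<^sup>*\<^sup>* (Case M N) (Case M' N)"
    using assms by - (erule rtranclp_map, rule red_red_elim.intros, assumption)+
  moreover have "N \<triangleright>* N' \<Longrightarrow> Pair M' N \<triangleright>* Pair M' N'"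
    by (erule rtranclp_map, rule red_red_elim.intros)
  moreover have "red_elim\<^sup>*\<^sup>* e e' \<Longrightarrow> App M' e \<triangleright>* App M' e'"
    by (erule rtranclp_map, rule red_red_elim.intros)
  moreover have "N \<triangleright>* N' \<Longrightarrow> red_elim\<^sup>*\<^sup>* (Case M' N) (Case M' N')"
    by (erule rtranclp_map, rule red_red_elim.intros)
  ultimately show "N \<triangleright>* N' \<Longrightarrow> Pair M N \<triangleright>* Pair M' N'"
    "red_elim\<^sup>*\<^sup>* e e' \<Longrightarrow> App M e \<triangleright>* App M' e'"
    "N \<triangleright>* N' \<Longrightarrow> red_elim\<^sup>*\<^sup>* (Case M N) (Case M' N')"
    by (metis rtranclp_trans)+
qed

lemma ren_reds: "M \<triangleright>* M' \<Longrightarrow> ren f g M \<triangleright>* ren f g M'"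
  by (simp add: ren_eq_sub reds_sub_term)

lemma ren_sreds: "sred\<^sup>*\<^sup>* s s' \<Longrightarrow> sred\<^sup>*\<^sup>* (map (ren_elim f g) s) (map (ren_elim f g) s')"
  by (erule rtranclp_map) (simp add: ren_eq_sub sred_sub)

lemma reds_lift:
  "\<forall>i. \<sigma> i \<triangleright>* \<sigma>' i \<Longrightarrow> lift_sub \<sigma> i \<triangleright>* lift_sub \<sigma>' i"
  "\<forall>i. \<sigma> i \<triangleright>* \<sigma>' i \<Longrightarrow> mlift_sub \<sigma> i \<triangleright>* mlift_sub \<sigma>' i"
  "msub_reds \<rho> \<rho>' \<Longrightarrow> msub_reds (lift_msub \<rho>) (lift_msub \<rho>')"
  "msub_reds \<rho> \<rho>' \<Longrightarrow> msub_reds (mlift_msub \<rho>) (mlift_msub \<rho>')"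
  by (auto simp: lift_sub_def mlift_sub_def msub_reds_def lift_msub_def mlift_msub_def ren_reds ren_sreds
      split: nat.splits)

text \<open>Many steps are unavoidable: a substituted term or stack may be copied or erased.\<close>

lemma reds_sub:
  "\<forall>i. \<sigma> i \<triangleright>* \<sigma>' i \<Longrightarrow> msub_reds \<rho> \<rho>' \<Longrightarrow> sub \<sigma> \<rho> M \<triangleright>* sub \<sigma>' \<rho>' M"
  "\<forall>i. \<sigma> i \<triangleright>* \<sigma>' i \<Longrightarrow> msub_reds \<rho> \<rho>' \<Longrightarrow> red_elim\<^sup>*\<^sup>* (sub_elim \<sigma> \<rho> e) (sub_elim \<sigma>' \<rho>' e)"
proof (induction M and e arbitrary: \<sigma> \<rho> \<sigma>' \<rho>' and \<sigma> \<rho> \<sigma>' \<rho>' rule: trm.induct elim.induct)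
  case (Nam a M)
  then show ?case by (auto simp: msub_reds_def intro!: reds_cong reds_apps)
qed (simp_all add: reds_cong reds_cong2 reds_lift)

lemma reds_subst: "M \<triangleright>* M' \<Longrightarrow> N \<triangleright>* N' \<Longrightarrow> subst M 0 N \<triangleright>* subst M' 0 N'"
  unfolding subst_eq_sub
  by (rule rtranclp_trans[OF reds_sub_term reds_sub(1)]) (auto simp: msub_reds_def split: nat.splits)

lemma reds_minst: "M \<triangleright>* M' \<Longrightarrow> sred\<^sup>*\<^sup>* s s' \<Longrightarrow> minst c s M \<triangleright>* minst c s' M'"
  by (rule rtranclp_trans[OF reds_sub_term reds_sub(1)]) (auto simp: msub_reds_def split: nat.splits)

section \<open>Strong normalization of stack applications\<close>

text \<open>The well-founded part of the converse of \<open>r\<close>, whose induction rule drives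
  the normalization arguments.\<close>

inductive sn :: "('b \<Rightarrow> 'b \<Rightarrow> bool) \<Rightarrow> 'b \<Rightarrow> bool" for r where
  snI: "(\<And>y. r x y \<Longrightarrow> sn r y) \<Longrightarrow> sn r x"

abbreviation SN :: "trm \<Rightarrow> bool" where
  "SN \<equiv> sn red"

abbreviation SNs :: "elim list \<Rightarrow> bool" where
  "SNs \<equiv> sn sred"

lemma sn_step: "sn r x \<Longrightarrow> r x y \<Longrightarrow> sn r y"
  by (erule sn.cases) simp

text \<open>An infinite \<open>r\<close>-sequence would be mapped by \<open>f\<close> to an infinite
  \<open>q\<close>-sequence.\<close>

lemma sn_simulation:
  assumes "sn q (f x)" "\<And>x y. r x y \<Longrightarrow> q (f x) (f y)"
  shows "sn r x"
  using assms(1)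
proof (induction "f x" arbitrary: x rule: sn.induct)
  case snI
  show ?case by (rule sn.snI) (use snI assms(2) in blast)
qed

lemma sn_rtranclp:
  assumes "sn r x" "r\<^sup>*\<^sup>* x y"
  shows "sn r y"
  using assms(2,1) by (induction rule: rtranclp_induct) (auto dest: sn_step)

lemma sn_tranclp:
  "sn r x \<Longrightarrow> sn r\<^sup>+\<^sup>+ x"
proof (induction rule: sn.induct)
  case (snI x)
  show ?case
  proof (rule sn.snI)
    fix y assume "r\<^sup>+\<^sup>+ x y"
    then obtain z where z: "r x z" "r\<^sup>*\<^sup>* z y" by (meson tranclpD)
    then have "sn r\<^sup>+\<^sup>+ z"
      using snI(2) by blast
    then show "sn r\<^sup>+\<^sup>+ y"
      using z(2) sn_step[of "r\<^sup>+\<^sup>+" z y] by (metis rtranclpD)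
  qed
qed

lemma SN_sub: "SN (sub \<sigma> \<rho> M) \<Longrightarrow> SN M"
  by (erule sn_simulation) (rule red_sub)

lemma SN_apps_D: "SN (apps M s) \<Longrightarrow> SN M"
  by (erule sn_simulation) (rule red_apps)

inductive_cases red_LamE: "Lam M \<triangleright> K"
inductive_cases red_MuE: "Mu M \<triangleright> K"
inductive_cases red_PairE: "Pair M N \<triangleright> K"
inductive_cases red_InjE: "Inj1 M \<triangleright> K" "Inj2 M \<triangleright> K"
inductive_cases red_NamE: "Nam a M \<triangleright> K"
inductive_cases red_VarE: "Var x \<triangleright> K"
inductive_cases red_ArgE: "red_elim (Arg M) e"
inductive_cases red_ProjE: "red_elim Proj1 e" "red_elim Proj2 e"
inductive_cases red_CaseE: "red_elim (Case M N) e"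
inductive_cases sred_NilE: "sred [] s"
inductive_cases sred_ConsE: "sred (e # s) s'"

section \<open>Strong normalization of constructors and stacks\<close>

lemma SN_Lam: "SN M \<Longrightarrow> SN (Lam M)"
  by (induction rule: sn.induct) (rule snI, auto elim!: red_LamE)

lemma SN_Mu: "SN M \<Longrightarrow> SN (Mu M)"
  by (induction rule: sn.induct) (rule snI, auto elim!: red_MuE)

lemma SN_Inj1: "SN M \<Longrightarrow> SN (Inj1 M)"
  by (induction rule: sn.induct) (rule snI, auto elim!: red_InjE)

lemma SN_Inj2: "SN M \<Longrightarrow> SN (Inj2 M)"
  by (induction rule: sn.induct) (rule snI, auto elim!: red_InjE)

lemma SN_Nam: "SN M \<Longrightarrow> SN (Nam a M)"
  by (induction rule: sn.induct) (rule snI, auto elim!: red_NamE)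

lemma SN_Pair: "SN M \<Longrightarrow> SN N \<Longrightarrow> SN (Pair M N)"
proof (induction arbitrary: N rule: sn.induct)
  case (snI M)
  note outer = snI(2)
  show ?case using snI(3)
  proof (induction rule: sn.induct)
    case (snI N)
    then have "SN N" by (blast intro: sn.snI)
    with snI outer show ?case by (intro sn.snI[of _ "Pair M N"]) (auto elim!: red_PairE)
  qed
qed

lemma SN_Var: "SN (Var x)"
  by (rule snI) (auto elim: red_VarE)

lemma SNs_Nil: "SNs []"
  by (rule snI) (auto elim: sred_NilE)

lemma SNs_ConsD: "SNs (e # s) \<Longrightarrow> SNs s"
  by (erule sn_simulation) (rule sred_tl)

lemma SNs_Proj1: "SNs s \<Longrightarrow> SNs (Proj1 # s)"
  by (induction rule: sn.induct) (rule snI, auto elim!: sred_ConsE red_ProjE)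

lemma SNs_Proj2: "SNs s \<Longrightarrow> SNs (Proj2 # s)"
  by (induction rule: sn.induct) (rule snI, auto elim!: sred_ConsE red_ProjE)

lemma SNs_Arg: "SN N \<Longrightarrow> SNs s \<Longrightarrow> SNs (Arg N # s)"
proof (induction arbitrary: s rule: sn.induct)
  case (snI N)
  note outer = snI(2)
  show ?case using snI(3)
  proof (induction rule: sn.induct)
    case (snI s)
    then have "SNs s" by (blast intro: sn.snI)
    with snI outer show ?case by (intro sn.snI[of _ "Arg N # s"]) (auto elim!: sred_ConsE red_ArgE)
  qed
qed

lemma sred_length: "sred s s' \<Longrightarrow> length s' \<le> length s"
  by (induction rule: sred.induct) auto

lemma sreds_length: "sred\<^sup>*\<^sup>* s s' \<Longrightarrow> length s' \<le> length s"
  by (induction rule: rtranclp_induct) (auto dest: sred_length)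

text \<open>
  A permutation at the front of the stack leaves both distributed branches unchanged and shortens
  the stack.
\<close>

lemma SNs_Case:
  assumes "SN (apps N1 (map (lift_elim 0) s))" "SN (apps N2 (map (lift_elim 0) s))"
  shows "SNs (Case N1 N2 # s)"
proof -
  \<comment> \<open>The pair serves as a measure that records the reductions of both distributed
    branches.\<close>
  let ?f = "\<lambda>N1 N2 s. Pair (apps N1 (map (lift_elim 0) s)) (apps N2 (map (lift_elim 0) s))"
  have lift: "sred (map (lift_elim 0) s) (map (lift_elim 0) s')" if "sred s s'" for s s'
    unfolding lift0 ren_eq_sub(2)[abs_def] by (rule sred_sub[OF that])
  have "SN (?f N1 N2 s)" using assms by (rule SN_Pair)
  \<comment> \<open>A step inside \<open>s\<close> changes both components and so costs two
    reductions of the pair; the transitive closure accounts for this.\<close>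
  then have "sn red\<^sup>+\<^sup>+ (?f N1 N2 s)" by (rule sn_tranclp)
  then show ?thesis
  proof (induction "?f N1 N2 s" arbitrary: N1 N2 s rule: sn.induct)
    case (snI N1 N2 s)
    have IH: "SNs (Case N1' N2' # s')" if "red\<^sup>+\<^sup>+ (?f N1 N2 s) (?f N1' N2' s')" for N1' N2' s'
      using snI(2)[OF that] by simp
    have "?f N1' N2' s' = ?f N1 N2 s \<Longrightarrow> SNs (Case N1' N2' # s')" for N1' N2' s'
    proof (induction "length s'" arbitrary: N1' N2' s' rule: less_induct)
      case less
      show ?case
      proof (rule sn.snI)
        fix t assume "sred (Case N1' N2' # s') t"
        then show "SNs t"
        proof (cases rule: sred.cases)
          case (sred_hd d)
          from sred_hd(2) show ?thesis unfolding sred_hd(1)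
            by (rule red_CaseE) (auto simp: less.prems[symmetric]
                intro!: IH tranclp.r_into_trancl red_red_elim.intros red_apps)
        next
          case (sred_tl u)
          have "?f N1' N2' s' \<triangleright> Pair (apps N1' (map (lift_elim 0) u)) (apps N2' (map (lift_elim 0) s'))"
            "Pair (apps N1' (map (lift_elim 0) u)) (apps N2' (map (lift_elim 0) s')) \<triangleright> ?f N1' N2' u"
            using lift[OF sred_tl(2)] by (auto intro: red_red_elim.intros sred_apps)
          then have "red\<^sup>+\<^sup>+ (?f N1' N2' s') (?f N1' N2' u)"
            by (rule tranclp.trancl_into_trancl[OF tranclp.r_into_trancl])
          then have "red\<^sup>+\<^sup>+ (?f N1 N2 s) (?f N1' N2' u)" by (simp only: less.prems)
          then show ?thesis unfolding sred_tl(1) by (rule IH)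
        next
          case (sred_perm e u)
          then show ?thesis using less.hyps[of u] less.prems by simp
        qed
      qed
    qed
    then show ?case by blast
  qed
qed

section \<open>Steps of a term applied to a stack\<close>

lemma is_App_apps: "(\<nexists>N e. M = App N e) \<Longrightarrow> (\<exists>N e. apps M s = App N e) \<longleftrightarrow> s \<noteq> []"
  by (cases s rule: rev_cases) auto

text \<open>Contractions of a head with its first eliminator. Permutation is absent, since inside a
  stack it is a step of \<open>sred\<close>.\<close>

inductive root :: "trm \<Rightarrow> elim \<Rightarrow> trm \<Rightarrow> bool" where
  "root (Lam M) (Arg N) (subst M 0 N)"
| "root (Mu M) e (Mu (msubst M 0 (mlift_elim 0 e)))"
| "root (Pair M1 M2) Proj1 M1"
| "root (Pair M1 M2) Proj2 M2"
| "root (Inj1 M) (Case N1 N2) (subst N1 0 M)"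
| "root (Inj2 M) (Case N1 N2) (subst N2 0 M)"

text \<open>The induction removes the last eliminator, which is the outermost one of the term. In a
  permutation at that place the \<open>Case\<close> must come from the stack, because
  \<open>M\<close> is not an application.\<close>

lemma red_apps_cases:
  assumes "apps M s \<triangleright> K" "\<nexists>N e. M = App N e"
  obtains M' where "M \<triangleright> M'" "K = apps M' s"
  | s' where "sred s s'" "K = apps M s'"
  | e r L where "s = e # r" "root M e L" "K = apps L r"
proof -
  have "(\<exists>M'. M \<triangleright> M' \<and> K = apps M' s) \<or> (\<exists>s'. sred s s' \<and> K = apps M s') \<or>
    (\<exists>e r L. s = e # r \<and> root M e L \<and> K = apps L r)"
    using assms(1)
  proof (induction s arbitrary: K rule: rev_induct)
    case (snoc e s)
    have nil: "s = [] \<and> M = H" if "apps M s = H" "\<nexists>N e. H = App N e" for H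
      using that is_App_apps[OF assms(2), of s] by auto
    from snoc.prems have "App (apps M s) e \<triangleright> K" by simp
    then show ?case
    proof (cases rule: red.cases)
      case (perm N N1 N2)
      then have "s \<noteq> []" using assms(2) by auto
      then obtain t where "s = t @ [Case N1 N2]" "N = apps M t"
        using perm(1) by (cases s rule: rev_cases) auto
      moreover have "sred (t @ [Case N1 N2, e])
          (t @ [Case (App N1 (lift_elim 0 e)) (App N2 (lift_elim 0 e))])"
        by (intro sred_append_left sred_perm)
      ultimately show ?thesis using perm by force
    next
      case (AppL N')
      then show ?thesis using snoc.IH[of N'] by (force intro: sred_append)
    next
      case (AppR e')
      have "sred (s @ [e]) (s @ [e'])" using AppR by (intro sred_append_left sred_hd)
      then show ?thesis using AppR by force
    qed (use nil root.intros in force)+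
  qed simp
  then show ?thesis using that by blast
qed

lemma nonApp_red: "M \<triangleright> M' \<Longrightarrow> \<nexists>N e. M = App N e \<Longrightarrow> \<nexists>N e. M' = App N e"
  by (erule red.cases) auto

text \<open>The only reductions of an application that cannot be charged to its parts are those of the
  head redex.\<close>

lemma SN_apps:
  assumes "SN M" "SNs s" "\<nexists>N e. M = App N e"
    "\<And>M' e r L. M \<triangleright>* M' \<Longrightarrow> sred\<^sup>*\<^sup>* s (e # r) \<Longrightarrow> root M' e L \<Longrightarrow> SN (apps L r)"
  shows "SN (apps M s)"
  using assms
proof (induction arbitrary: s rule: sn.induct)
  case (snI M)
  \<comment> \<open>Nested induction on \<open>M\<close> and then \<open>s\<close>: the assumption
    on head redexes speaks of all reducts, so it is inherited by them.\<close>
  note outer = snI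
  show ?case using snI(3,5)
  proof (induction rule: sn.induct)
    case (snI s)
    show ?case
    proof (rule sn.snI)
      fix K assume "apps M s \<triangleright> K"
      then show "SN K" using outer(4)
      proof (cases rule: red_apps_cases)
        case (1 M')
        have "SN (apps M' s)"
        proof (rule outer(2)[OF 1(1) sn.snI[OF snI(1)] nonApp_red[OF 1(1) outer(4)]])
          fix N e r L assume "M' \<triangleright>* N" "sred\<^sup>*\<^sup>* s (e # r)" "root N e L"
          then show "SN (apps L r)" using 1(1) snI(3) by (meson converse_rtranclp_into_rtranclp)
        qed
        then show ?thesis using 1 by simp
      next
        case (2 s')
        have "SN (apps M s')"
        proof (rule snI(2)[OF 2(1)])
          fix N e r L assume "M \<triangleright>* N" "sred\<^sup>*\<^sup>* s' (e # r)" "root N e L"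
          then show "SN (apps L r)" using 2(1) snI(3) by (meson converse_rtranclp_into_rtranclp)
        qed
        then show ?thesis using 2 by simp
      next
        case (3 e r L)
        then show ?thesis using snI(3) by blast
      qed
    qed
  qed
qed

section \<open>Expansion of head redexes\<close>

inductive_cases root_E: "root M e L"

lemma no_root: "\<not> root (Var x) e L"
  by (auto elim: root_E)

lemma reds_Var: "Var x \<triangleright>* M \<Longrightarrow> M = Var x"
  by (erule converse_rtranclpE) (auto elim: red_VarE)

lemma SN_Var_apps: "SNs s \<Longrightarrow> SN (apps (Var x) s)"
  by (rule SN_apps) (auto simp: SN_Var no_root dest: reds_Var)

lemma reds_inv:
  "Lam M \<triangleright>* K \<Longrightarrow> \<exists>M'. K = Lam M' \<and> M \<triangleright>* M'"
  "Mu M \<triangleright>* K \<Longrightarrow> \<exists>M'. K = Mu M' \<and> M \<triangleright>* M'"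
  "Inj1 M \<triangleright>* K \<Longrightarrow> \<exists>M'. K = Inj1 M' \<and> M \<triangleright>* M'"
  "Inj2 M \<triangleright>* K \<Longrightarrow> \<exists>M'. K = Inj2 M' \<and> M \<triangleright>* M'"
  "Pair M N \<triangleright>* K \<Longrightarrow> \<exists>M' N'. K = Pair M' N' \<and> M \<triangleright>* M' \<and> N \<triangleright>* N'"
proof -
  show "Lam M \<triangleright>* K \<Longrightarrow> \<exists>M'. K = Lam M' \<and> M \<triangleright>* M'"
    by (induction rule: rtranclp_induct) (auto elim!: red_LamE intro: rtranclp.rtrancl_into_rtrancl)
  show "Mu M \<triangleright>* K \<Longrightarrow> \<exists>M'. K = Mu M' \<and> M \<triangleright>* M'"
    by (induction rule: rtranclp_induct) (auto elim!: red_MuE intro: rtranclp.rtrancl_into_rtrancl)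
  show "Inj1 M \<triangleright>* K \<Longrightarrow> \<exists>M'. K = Inj1 M' \<and> M \<triangleright>* M'"
    by (induction rule: rtranclp_induct) (auto elim!: red_InjE intro: rtranclp.rtrancl_into_rtrancl)
  show "Inj2 M \<triangleright>* K \<Longrightarrow> \<exists>M'. K = Inj2 M' \<and> M \<triangleright>* M'"
    by (induction rule: rtranclp_induct) (auto elim!: red_InjE intro: rtranclp.rtrancl_into_rtrancl)
  show "Pair M N \<triangleright>* K \<Longrightarrow> \<exists>M' N'. K = Pair M' N' \<and> M \<triangleright>* M' \<and> N \<triangleright>* N'"
    by (induction rule: rtranclp_induct) (auto elim!: red_PairE intro: rtranclp.rtrancl_into_rtrancl)
qed

text \<open>Only a \<open>Case\<close> can absorb its successor, so an argument or a projection
  stays at the front.\<close>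

lemma sreds_inv:
  "sred\<^sup>*\<^sup>* (Arg N # s) t \<Longrightarrow> \<exists>N' s'. t = Arg N' # s' \<and> N \<triangleright>* N' \<and> sred\<^sup>*\<^sup>* s s'"
  "sred\<^sup>*\<^sup>* (Proj1 # s) t \<Longrightarrow> \<exists>s'. t = Proj1 # s' \<and> sred\<^sup>*\<^sup>* s s'"
  "sred\<^sup>*\<^sup>* (Proj2 # s) t \<Longrightarrow> \<exists>s'. t = Proj2 # s' \<and> sred\<^sup>*\<^sup>* s s'"
proof -
  show "sred\<^sup>*\<^sup>* (Arg N # s) t \<Longrightarrow> \<exists>N' s'. t = Arg N' # s' \<and> N \<triangleright>* N' \<and> sred\<^sup>*\<^sup>* s s'"
    by (induction rule: rtranclp_induct)
      (auto elim!: sred_ConsE red_ArgE intro: rtranclp.rtrancl_into_rtrancl)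
  show "sred\<^sup>*\<^sup>* (Proj1 # s) t \<Longrightarrow> \<exists>s'. t = Proj1 # s' \<and> sred\<^sup>*\<^sup>* s s'"
    by (induction rule: rtranclp_induct)
      (auto elim!: sred_ConsE red_ProjE intro: rtranclp.rtrancl_into_rtrancl)
  show "sred\<^sup>*\<^sup>* (Proj2 # s) t \<Longrightarrow> \<exists>s'. t = Proj2 # s' \<and> sred\<^sup>*\<^sup>* s s'"
    by (induction rule: rtranclp_induct)
      (auto elim!: sred_ConsE red_ProjE intro: rtranclp.rtrancl_into_rtrancl)
qed

lemma subst_App_lift:
  "subst (App N (lift_elim 0 e)) 0 M = App (subst N 0 M) e"
proof -
  have "subst_elim (lift_elim 0 e) 0 M = sub_elim (case_nat M Var) id_msub (ren_elim Suc id e)"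
    by (auto simp: subst_eq_sub_index lift0 fun_eq_iff
        intro!: arg_cong2[where f="\<lambda>f g. sub_elim f g _"] split: nat.splits)
  then show ?thesis by (simp add: case_nat_sub_lift sub_id)
qed

text \<open>A front permutation moves an eliminator from the rest of the stack into the branches.
  The instantiated branch applied to the rest is then literally the same term, so this combination
  is what is tracked.\<close>

lemma sred_Case_inv:
  assumes "sred (Case N1 N2 # s) t"
  shows "\<exists>N1' N2' s'. t = Case N1' N2' # s' \<and>
     (\<forall>M. apps (subst N1 0 M) s \<triangleright>* apps (subst N1' 0 M) s' \<and>
          apps (subst N2 0 M) s \<triangleright>* apps (subst N2' 0 M) s')"
  using assms
proof (cases rule: sred.cases)
  case (sred_hd e')
  from sred_hd show ?thesis
    by (auto elim!: red_CaseE intro!: reds_apps reds_subst)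
next
  case (sred_tl u)
  then show ?thesis by (auto intro!: reds_apps)
next
  case (sred_perm e u)
  then show ?thesis by (auto simp: subst_App_lift simp del: subst.simps)
qed

lemma sreds_Case_inv:
  "sred\<^sup>*\<^sup>* (Case N1 N2 # s) t \<Longrightarrow> \<exists>N1' N2' s'. t = Case N1' N2' # s' \<and>
     (\<forall>M. apps (subst N1 0 M) s \<triangleright>* apps (subst N1' 0 M) s' \<and>
          apps (subst N2 0 M) s \<triangleright>* apps (subst N2' 0 M) s')"
proof (induction rule: rtranclp_induct)
  case (step t t')
  then obtain N1' N2' s' where t: "t = Case N1' N2' # s'" and
    IH: "\<And>M. apps (subst N1 0 M) s \<triangleright>* apps (subst N1' 0 M) s'"
      "\<And>M. apps (subst N2 0 M) s \<triangleright>* apps (subst N2' 0 M) s'"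
    by blast
  from sred_Case_inv[OF step(2)[unfolded t]] obtain N1'' N2'' s'' where t': "t' = Case N1'' N2'' # s''" and
    "\<And>M. apps (subst N1' 0 M) s' \<triangleright>* apps (subst N1'' 0 M) s''"
    "\<And>M. apps (subst N2' 0 M) s' \<triangleright>* apps (subst N2'' 0 M) s''"
    by blast
  with IH have "apps (subst N1 0 M) s \<triangleright>* apps (subst N1'' 0 M) s''"
    "apps (subst N2 0 M) s \<triangleright>* apps (subst N2'' 0 M) s''" for M
    by (meson rtranclp_trans)+
  with t' show ?case by blast
qed blast

text \<open>Every head contraction reachable from this term yields a reduct of the term in the first
  assumption. Normalization of \<open>N\<close> is demanded separately since the substitution may
  erase it.\<close>

lemma SN_Lam_apps:
  assumes "SN (apps (subst M 0 N) s)" "SN N" "SNs s"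
  shows "SN (apps (Lam M) (Arg N # s))"
proof (rule SN_apps)
  have "SN (subst M 0 N)" using assms(1) by (rule SN_apps_D)
  then show "SN (Lam M)" unfolding subst_eq_sub by (intro SN_Lam) (rule SN_sub)
  show "SNs (Arg N # s)" using assms by (intro SNs_Arg)
  fix M' e r L assume "Lam M \<triangleright>* M'" and s: "sred\<^sup>*\<^sup>* (Arg N # s) (e # r)" and root: "root M' e L"
  then obtain K N' where K: "M' = Lam K" "M \<triangleright>* K" "e = Arg N'" "N \<triangleright>* N'" "sred\<^sup>*\<^sup>* s r"
    by (auto dest!: reds_inv sreds_inv)
  with root have "L = subst K 0 N'" by (auto elim: root_E)
  with K have "apps (subst M 0 N) s \<triangleright>* apps L r" by (auto intro: reds_apps reds_subst)
  then show "SN (apps L r)" by (rule sn_rtranclp[OF assms(1)])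
qed simp

lemma SN_Pair_apps:
  assumes "SN (apps M s)" "SN N" "SNs s"
  shows "SN (apps (Pair M N) (Proj1 # s))" "SN (apps (Pair N M) (Proj2 # s))"
proof -
  have pair: "SN (Pair M N)" "SN (Pair N M)"
    using SN_apps_D[OF assms(1)] assms(2) by (auto intro: SN_Pair)
  show "SN (apps (Pair M N) (Proj1 # s))"
  proof (rule SN_apps)
    fix M' e r L assume "Pair M N \<triangleright>* M'" and s: "sred\<^sup>*\<^sup>* (Proj1 # s) (e # r)" and root: "root M' e L"
    then have "apps M s \<triangleright>* apps L r"
      by (auto dest!: reds_inv sreds_inv elim!: root_E intro: reds_apps)
    then show "SN (apps L r)" by (rule sn_rtranclp[OF assms(1)])
  qed (use pair assms(3) in \<open>auto intro: SNs_Proj1 SNs_Proj2\<close>)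
  show "SN (apps (Pair N M) (Proj2 # s))"
  proof (rule SN_apps)
    fix M' e r L assume "Pair N M \<triangleright>* M'" and s: "sred\<^sup>*\<^sup>* (Proj2 # s) (e # r)" and root: "root M' e L"
    then have "apps M s \<triangleright>* apps L r"
      by (auto dest!: reds_inv sreds_inv elim!: root_E intro: reds_apps)
    then show "SN (apps L r)" by (rule sn_rtranclp[OF assms(1)])
  qed (use pair assms(3) in \<open>auto intro: SNs_Proj1 SNs_Proj2\<close>)
qed

lemma SN_Inj_apps:
  assumes "SN M" "SNs (Case N1 N2 # s)"
  shows "SN (apps (subst N1 0 M) s) \<Longrightarrow> SN (apps (Inj1 M) (Case N1 N2 # s))"
    "SN (apps (subst N2 0 M) s) \<Longrightarrow> SN (apps (Inj2 M) (Case N1 N2 # s))"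
proof -
  assume sn: "SN (apps (subst N1 0 M) s)"
  show "SN (apps (Inj1 M) (Case N1 N2 # s))"
  proof (rule SN_apps)
    fix K e r L assume "Inj1 M \<triangleright>* K" and s: "sred\<^sup>*\<^sup>* (Case N1 N2 # s) (e # r)" and root: "root K e L"
    then obtain M' N1' N2' where *: "K = Inj1 M'" "M \<triangleright>* M'" "e = Case N1' N2'"
      "apps (subst N1 0 M) s \<triangleright>* apps (subst N1' 0 M) r"
      by (auto dest!: reds_inv sreds_Case_inv)
    then have "apps (subst N1 0 M) s \<triangleright>* apps (subst N1' 0 M') r"
      by (auto elim!: rtranclp_trans intro!: reds_apps reds_subst)
    moreover have "L = subst N1' 0 M'" using root * by (auto elim: root_E)
    ultimately show "SN (apps L r)" using sn_rtranclp[OF sn] by simp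
  qed (use assms in \<open>auto intro: SN_Inj1\<close>)
next
  assume sn: "SN (apps (subst N2 0 M) s)"
  show "SN (apps (Inj2 M) (Case N1 N2 # s))"
  proof (rule SN_apps)
    fix K e r L assume "Inj2 M \<triangleright>* K" and s: "sred\<^sup>*\<^sup>* (Case N1 N2 # s) (e # r)" and root: "root K e L"
    then obtain M' N1' N2' where *: "K = Inj2 M'" "M \<triangleright>* M'" "e = Case N1' N2'"
      "apps (subst N2 0 M) s \<triangleright>* apps (subst N2' 0 M) r"
      by (auto dest!: reds_inv sreds_Case_inv)
    then have "apps (subst N2 0 M) s \<triangleright>* apps (subst N2' 0 M') r"
      by (auto elim!: rtranclp_trans intro!: reds_apps reds_subst)
    moreover have "L = subst N2' 0 M'" using root * by (auto elim: root_E)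
    ultimately show "SN (apps L r)" using sn_rtranclp[OF sn] by simp
  qed (use assms in \<open>auto intro: SN_Inj2\<close>)
qed

text \<open>Induction on the length of the stack, which stack reduction never increases and each
  head contraction decreases. By \<open>minst_msubst\<close>, the body after the contraction, opened
  with the remaining stack, is a reduct of the given opened body.\<close>

lemma SN_Mu_apps:
  assumes "SN (minst c s M)" "SNs s"
  shows "SN (apps (Mu M) s)"
  using assms
proof (induction "length s" arbitrary: M s rule: less_induct)
  case less
  show ?case
  proof (rule SN_apps)
    show "SN (Mu M)" using less.prems(1) by (intro SN_Mu) (rule SN_sub)
    fix M' e r L assume "Mu M \<triangleright>* M'" and s: "sred\<^sup>*\<^sup>* s (e # r)" and root: "root M' e L"
    then obtain N where N: "M' = Mu N" "M \<triangleright>* N" by (blast dest: reds_inv)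
    with root have L: "L = Mu (msubst N 0 (mlift_elim 0 e))" by (auto elim: root_E)
    have "minst c s M \<triangleright>* minst c (e # r) N" using N s by (intro reds_minst)
    then have "SN (minst c r (msubst N 0 (mlift_elim 0 e)))"
      unfolding minst_msubst using less.prems(1) by (rule sn_rtranclp[rotated])
    moreover have "length r < length s" using sreds_length[OF s] by simp
    moreover have "SNs r" using sn_rtranclp[OF less.prems(2) s] by (rule SNs_ConsD)
    ultimately show "SN (apps L r)" unfolding L by (intro less.hyps)
  qed (use less.prems in auto)
qed

section \<open>Positive systems of type equations\<close>

lemma gen_cong_mono: "gen_cong J X F A B \<Longrightarrow> J \<subseteq> I \<Longrightarrow> gen_cong I X F A B"
proof (induction rule: gen_cong.induct)
  case (gen i)
  then show ?case by (auto intro: gen_cong.gen)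
next
  case (sym A B)
  then show ?case by (simp add: gen_cong.sym)
next
  case (trans A B C)
  then show ?case using gen_cong.trans[of I X F A B C] by simp
qed (simp_all add: gen_cong.refl gen_cong.Fun gen_cong.Conj gen_cong.Disj)

lemma mono_gen_cong: "mono (\<lambda>J. gen_cong J X F A B)"
  by (rule monoI, rule le_boolI, erule gen_cong_mono)

text \<open>Premises of a rule may use different finite sets of equations; by monotonicity the union
  serves them all.\<close>

lemma finite_subset_conj:
  assumes "\<exists>J\<subseteq>I. finite J \<and> P J" "\<exists>J\<subseteq>I. finite J \<and> Q J" and "mono P" "mono Q"
  shows "\<exists>J\<subseteq>I. finite J \<and> P J \<and> Q J"
proof -
  obtain J K where "J \<subseteq> I" "finite J" "P J" "K \<subseteq> I" "finite K" "Q K"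
    using assms(1,2) by blast
  moreover have "P (J \<union> K)" "Q (J \<union> K)"
    using calculation monoD[OF assms(3), of J "J \<union> K"] monoD[OF assms(4), of K "J \<union> K"] by auto
  ultimately show ?thesis by (intro exI[of _ "J \<union> K"]) simp
qed

lemma mono_conj: "mono P \<Longrightarrow> mono Q \<Longrightarrow> mono (\<lambda>J. P J \<and> Q J)"
  by (auto simp: mono_def)

lemma gen_cong_finite:
  "gen_cong I X F A B \<Longrightarrow> \<exists>J\<subseteq>I. finite J \<and> gen_cong J X F A B"
proof (induction rule: gen_cong.induct)
  case (gen i)
  then show ?case by (intro exI[of _ "{i}"]) (simp add: gen_cong.gen)
next
  case (refl A)
  show ?case by (intro exI[of _ "{}"]) (simp add: gen_cong.refl)
next
  case (sym A B)
  then show ?case by (meson gen_cong.sym)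
next
  case (trans A B C)
  from finite_subset_conj[OF trans.IH mono_gen_cong mono_gen_cong] show ?case by (meson gen_cong.trans)
next
  case (Fun A A' B B')
  from finite_subset_conj[OF Fun.IH mono_gen_cong mono_gen_cong] show ?case by (meson gen_cong.Fun)
next
  case (Conj A A' B B')
  from finite_subset_conj[OF Conj.IH mono_gen_cong mono_gen_cong] show ?case by (meson gen_cong.Conj)
next
  case (Disj A A' B B')
  from finite_subset_conj[OF Disj.IH mono_gen_cong mono_gen_cong] show ?case by (meson gen_cong.Disj)
qed

lemma typing_mono: "typing R \<Gamma> \<Delta> M A \<Longrightarrow> R \<le> R' \<Longrightarrow> typing R' \<Gamma> \<Delta> M A"
proof (induction rule: typing.induct)
  case (conv \<Gamma> \<Delta> M A B)
  then show ?case by (meson typing.conv predicate2D)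
qed (blast intro: typing.ax,
    blast intro: typing.impI,
    blast intro: typing.impE,
    blast intro: typing.botI,
    blast intro: typing.botE,
    blast intro: typing.conjI,
    blast intro: typing.conjE1,
    blast intro: typing.conjE2,
    blast intro: typing.disjI1,
    blast intro: typing.disjI2,
    blast intro: typing.disjE)

lemma mono_typing: "mono (\<lambda>J. typing (gen_cong J X F) \<Gamma> \<Delta> M A)"
  by (rule monoI, rule le_boolI, erule typing_mono, rule predicate2I, erule gen_cong_mono)

lemma typing_finite:
  "typing (gen_cong I X F) \<Gamma> \<Delta> M A \<Longrightarrow> \<exists>J\<subseteq>I. finite J \<and> typing (gen_cong J X F) \<Gamma> \<Delta> M A"
proof (induction rule: typing.induct)
  case (ax \<Gamma> x A \<Delta>)
  then show ?case by (intro exI[of _ "{}"]) (simp add: typing.ax)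
next
  case impI
  then show ?case by (meson typing.impI)
next
  case botI
  then show ?case by (meson typing.botI)
next
  case botE
  then show ?case by (meson typing.botE)
next
  case conjE1
  then show ?case by (meson typing.conjE1)
next
  case conjE2
  then show ?case by (meson typing.conjE2)
next
  case disjI1
  then show ?case by (meson typing.disjI1)
next
  case disjI2
  then show ?case by (meson typing.disjI2)
next
  case impE
  from finite_subset_conj[OF impE.IH mono_typing mono_typing] show ?case
    by (meson typing.impE)
next
  case conjI
  from finite_subset_conj[OF conjI.IH mono_typing mono_typing] show ?case
    by (meson typing.conjI)
next
  case disjE
  from finite_subset_conj[OF finite_subset_conj[OF disjE.IH(1,2) mono_typing mono_typing] disjE.IH(3)
      mono_conj[OF mono_typing mono_typing] mono_typing]
  show ?case by (meson typing.disjE)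
next
  case conv
  from finite_subset_conj[OF conv.IH gen_cong_finite[OF conv.hyps(2)] mono_typing mono_gen_cong]
  show ?case by (meson typing.conv)
qed

section \<open>Signed occurrences and walks in the dependency graph\<close>

text \<open>The sign of an occurrence is a Boolean, \<open>True\<close> for positive; \<open>(=)\<close> multiplies signs.\<close>

primrec occ :: "bool \<Rightarrow> 'a \<Rightarrow> 'a ty \<Rightarrow> bool" where
  "occ b a (Atom c) \<longleftrightarrow> b \<and> c = a"
| "occ b a Bot \<longleftrightarrow> False"
| "occ b a (Fun A B) \<longleftrightarrow> occ (\<not> b) a A \<or> occ b a B"
| "occ b a (Conj A B) \<longleftrightarrow> occ b a A \<or> occ b a B"
| "occ b a (Disj A B) \<longleftrightarrow> occ b a A \<or> occ b a B"

text \<open>This is how goodness is exploited: it forbids occurrences of the wrong sign.\<close>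

lemma pos_neg_occ: "A \<in> pos a \<Longrightarrow> \<not> occ False a A" "A \<in> neg a \<Longrightarrow> \<not> occ True a A"
  by (induction rule: pos_neg.inducts) auto

primrec tsubst :: "'a \<Rightarrow> 'a ty \<Rightarrow> 'a ty \<Rightarrow> 'a ty" where
  "tsubst a C (Atom c) = (if c = a then C else Atom c)"
| "tsubst a C Bot = Bot"
| "tsubst a C (Fun A B) = Fun (tsubst a C A) (tsubst a C B)"
| "tsubst a C (Conj A B) = Conj (tsubst a C A) (tsubst a C B)"
| "tsubst a C (Disj A B) = Disj (tsubst a C A) (tsubst a C B)"

lemma gen_cong_tsubst: "gen_cong I X F (Atom a) C \<Longrightarrow> gen_cong I X F A (tsubst a C A)"
  by (induction A) (simp_all add: gen_cong.refl gen_cong.Fun gen_cong.Conj gen_cong.Disj)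

lemma occ_tsubst: "occ b c A \<Longrightarrow> occ s d C \<Longrightarrow> occ (b = s) d (tsubst c C A)"
proof (induction A arbitrary: b)
  case (Fun A B)
  then show ?case
    using Fun.IH(1)[of "\<not> b"] Fun.IH(2)[of b] by (cases b; cases s) auto
qed auto

text \<open>An occurrence of \<open>d\<close> in \<open>G c\<close> is an edge from \<open>c\<close>
  to \<open>d\<close> carrying its sign. The Boolean is the product of the signs along the walk, and
  all vertices lie in \<open>D\<close>.\<close>

inductive walk :: "'a set \<Rightarrow> ('a \<Rightarrow> 'a ty) \<Rightarrow> 'a \<Rightarrow> bool \<Rightarrow> 'a \<Rightarrow> bool" for D G a where
  walk_refl: "a \<in> D \<Longrightarrow> walk D G a True a"
| walk_step: "walk D G a b c \<Longrightarrow> occ s d (G c) \<Longrightarrow> d \<in> D \<Longrightarrow> walk D G a (b = s) d"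

lemma walk_in: "walk D G a b c \<Longrightarrow> c \<in> D"
  by (induction rule: walk.induct) auto

lemma walk_mono: "walk D G a b c \<Longrightarrow> D \<subseteq> D' \<Longrightarrow> walk D' G a b c"
proof (induction rule: walk.induct)
  case (walk_step b c s d)
  then show ?case by (intro walk.walk_step[of D' G a b c s d]) auto
qed (auto intro: walk.walk_refl)

lemma walk_trans: "walk D G c s d \<Longrightarrow> walk D G a b c \<Longrightarrow> walk D G a (b = s) d"
proof (induction rule: walk.induct)
  case (walk_step s d t e)
  then have "walk D G a ((b = s) = t) e" using walk.walk_step[of D G a "b = s" d t e] by simp
  moreover have "((b = s) = t) = (b = (s = t))" by auto
  ultimately show ?case by simp
qed simp

text \<open>Following an edge out of \<open>c\<close> replaces \<open>c\<close> by
  \<open>G c\<close> in the type reached so far; signs multiply by \<open>occ_tsubst\<close>. A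
  negative closed walk thus makes an atom congruent to a type in which it occurs negatively.\<close>

lemma walk_unfold:
  assumes "\<And>c. c \<in> D \<Longrightarrow> gen_cong I X F (Atom c) (G c)"
  shows "walk D G a b c \<Longrightarrow> \<exists>A. gen_cong I X F (Atom a) A \<and> occ b c A"
proof (induction rule: walk.induct)
  case walk_refl
  then show ?case by (intro exI[of _ "Atom a"]) (auto intro: gen_cong.refl)
next
  case (walk_step b c s d)
  then obtain A where "gen_cong I X F (Atom a) A" "occ b c A" by blast
  moreover have "gen_cong I X F (Atom c) (G c)" using walk_step walk_in assms by metis
  ultimately show ?case
    using walk_step occ_tsubst gen_cong_tsubst gen_cong.trans by metis
qed

text \<open>
  The sign of an atom in a terminal strongly connected component is taken relative to a base atom.
  Reversing the order at the negative atoms is implemented by complementing the values there.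
\<close>

lemma solve_equations:
  fixes S :: "('a \<Rightarrow> 'b set) \<Rightarrow> 'a ty \<Rightarrow> 'b set"
  assumes mono: "\<And>v w A. (\<And>a. occ True a A \<Longrightarrow> v a \<subseteq> w a) \<Longrightarrow> (\<And>a. occ False a A \<Longrightarrow> w a \<subseteq> v a)
      \<Longrightarrow> S v A \<subseteq> S w A"
  shows "finite D \<Longrightarrow> (\<And>a. \<not> walk D G a False a) \<Longrightarrow>
    \<exists>v. (\<forall>a. a \<notin> D \<longrightarrow> v a = v0 a) \<and> (\<forall>a\<in>D. v a = S v (G a))"
proof (induction D arbitrary: v0 rule: finite_psubset_induct)
  case (psubset D)
  show ?case
  proof (cases "D = {}")
    case True
    then show ?thesis by auto
  next
    case False
    let ?r = "\<lambda>a. {c. \<exists>b. walk D G a b c}"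
    have fin: "finite (?r a)" for a
      by (rule finite_subset[OF _ psubset.hyps]) (auto dest: walk_in)
    \<comment> \<open>An atom with the fewest reachable atoms lies in a terminal component: whatever
      it reaches has the same reachable set and hence leads back to it.\<close>
    obtain a where a: "a \<in> D" "\<And>c. c \<in> D \<Longrightarrow> card (?r a) \<le> card (?r c)"
      using False ex_has_least_nat[of "\<lambda>a. a \<in> D" _ "\<lambda>a. card (?r a)"] by blast
    let ?T = "?r a"
    have ret: "\<exists>b. walk D G c b a" if c: "c \<in> ?T" for c
    proof -
      have "?r c \<subseteq> ?T" using c walk_trans by fast
      moreover have "c \<in> D" using c walk_in by fast
      ultimately have "?r c = ?T" using a(2) fin by (simp add: card_seteq)
      moreover have "a \<in> ?T" using a(1) walk_refl by fast
      ultimately show ?thesis by blast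
    qed
    define col where "col c \<longleftrightarrow> walk D G a True c" for c
    \<comment> \<open>Two walks of opposite sign to \<open>c\<close>, closed by one walk back, would
      give closed walks of both signs at \<open>a\<close>.\<close>
    have col: "b = col c" if walk: "walk D G a b c" for b c
    proof (rule ccontr)
      assume "b \<noteq> col c"
      with walk have "walk D G a True c" "walk D G a False c"
        by (cases b; auto simp: col_def)+
      moreover obtain s where "walk D G c s a" using ret walk by blast
      ultimately have "walk D G a s a" "walk D G a (\<not> s) a"
        using walk_trans by fastforce+
      then show False using psubset.prems by (cases s) auto
    qed
    \<comment> \<open>Decodes an assignment on the reordered component by complementing it at
      negative atoms. Atoms of \<open>D\<close> outside \<open>?T\<close> do not occur in the
      equations of \<open>?T\<close>, so the value \<open>v0\<close> given to them has no effect
      there.\<close>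
    define dec where "dec u d = (if d \<in> ?T then if col d then u d else - u d else v0 d)"
      for u :: "'a \<Rightarrow> 'b set" and d
    define \<Phi> where "\<Phi> u c = (if col c then S (dec u) (G c) else - S (dec u) (G c))" for u c
    have step: "if col c then S (dec u) (G c) \<subseteq> S (dec u') (G c) else S (dec u') (G c) \<subseteq> S (dec u) (G c)"
      if c: "c \<in> ?T" and u: "u \<le> u'" for u u' c
    proof -
      \<comment> \<open>Along an edge the colour changes exactly when the edge is negative; this
        turns polarity into monotonicity.\<close>
      have *: "col d = (col c = s)" if "occ s d (G c)" "d \<in> D" for s d
      proof -
        obtain b where b: "walk D G a b c" using c by blast
        show ?thesis using col[OF walk_step[OF b that]] col[OF b] by simp
      qed
      have **: "dec u d \<subseteq> dec u' d" if "d \<in> ?T \<longrightarrow> col d" for d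
        using that u by (auto simp: dec_def le_fun_def)
      have ***: "dec u' d \<subseteq> dec u d" if "d \<in> ?T \<longrightarrow> \<not> col d" for d
        using that u by (auto simp: dec_def le_fun_def)
      have "d \<in> D" if "d \<in> ?T" for d using that walk_in by fast
      with * ** *** have "dec u d \<subseteq> dec u' d" if "occ (col c) d (G c)" for d
        using that by blast
      moreover from \<open>\<And>d. d \<in> ?T \<Longrightarrow> d \<in> D\<close> * ***
      have "dec u' d \<subseteq> dec u d" if "occ (\<not> col c) d (G c)" for d
        using that by blast
      ultimately show ?thesis by (cases "col c") (simp_all add: mono)
    qed
    \<comment> \<open>Monotonicity is known on \<open>?T\<close> only, so the operator is made
      constant elsewhere.\<close>
    define \<Psi> where "\<Psi> u c = (if c \<in> ?T then \<Phi> u c else {})" for u c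
    have "mono \<Psi>"
    proof (intro monoI le_funI)
      fix u u' :: "'a \<Rightarrow> 'b set" and c assume "u \<le> u'"
      then show "\<Psi> u c \<le> \<Psi> u' c" using step[of c u u'] by (auto simp: \<Psi>_def \<Phi>_def split: if_splits)
    qed
    then have unf: "lfp \<Psi> = \<Psi> (lfp \<Psi>)" by (rule lfp_unfold)
    define v1 where "v1 = dec (lfp \<Psi>)"
    have v1: "v1 c = S v1 (G c)" if "c \<in> ?T" for c
      using that fun_cong[OF unf, of c] unfolding v1_def
      by (subst (1) dec_def) (auto simp: \<Psi>_def \<Phi>_def)
    \<comment> \<open>The remaining atoms are solved with \<open>v1\<close> as the prescribed values
      outside them, which preserves the solution on \<open>?T\<close>. The induction is over
      arbitrary \<open>v0\<close> for this purpose.\<close>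
    have "D - ?T \<subset> D" using a(1) walk_refl by fast
    moreover have "\<not> walk (D - ?T) G c False c" for c
      using psubset.prems walk_mono[of "D - ?T" G c False c D] by blast
    ultimately obtain v where v: "\<And>c. c \<notin> D - ?T \<Longrightarrow> v c = v1 c" "\<And>c. c \<in> D - ?T \<Longrightarrow> v c = S v (G c)"
      using psubset.IH[of "D - ?T" v1] by blast
    have "v c = S v (G c)" if c: "c \<in> ?T" for c
    proof -
      \<comment> \<open>Since \<open>?T\<close> is closed under edges, an atom occurring here is
        either in \<open>?T\<close> or outside \<open>D\<close>, where \<open>v\<close> has not
        departed from \<open>v1\<close>.\<close>
      have eq: "v d = v1 d" if "occ s d (G c)" for s d
        using c v(1)[of d] that walk_step by fast
      have "S v (G c) = S v1 (G c)" using eq by (intro subset_antisym mono) auto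
      then show ?thesis using v1[OF c] v(1) c by simp
    qed
    moreover have "v c = v0 c" if "c \<notin> D" for c
    proof -
      have "c \<notin> ?T" using that walk_in by fast
      then show ?thesis using v(1)[of c] that by (simp add: v1_def dec_def)
    qed
    moreover have "v c = S v (G c)" if "c \<in> D" "c \<notin> ?T" for c
      using v(2)[of c] that by simp
    ultimately show ?thesis by (intro exI[of _ v]) metis
  qed
qed

section \<open>Reducibility\<close>

definition ort :: "elim list set \<Rightarrow> trm set" where
  "ort T = {M. \<forall>s\<in>T. SN (apps M s)}"

text \<open>The empty stack is always included, so that reducible terms are strongly normalizing.
  Valuations are arbitrary sets; cutting them down to strongly normalizing stacks at atoms keeps
  variables reducible.\<close>

primrec stacks :: "('a \<Rightarrow> elim list set) \<Rightarrow> 'a ty \<Rightarrow> elim list set" where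
  "stacks v (Atom a) = insert [] (v a \<inter> Collect SNs)"
| "stacks v Bot = {[]}"
| "stacks v (Fun A B) = insert [] {Arg N # s | N s. N \<in> ort (stacks v A) \<and> s \<in> stacks v B}"
| "stacks v (Conj A B) = insert [] ((#) Proj1 ` stacks v A \<union> (#) Proj2 ` stacks v B)"
| "stacks v (Disj A B) = insert [] {Case N1 N2 # s | N1 N2 s.
     (\<forall>P\<in>ort (stacks v A). SN (apps (subst N1 0 P) s)) \<and>
     (\<forall>P\<in>ort (stacks v B). SN (apps (subst N2 0 P) s))}"

lemma ort_anti: "S \<subseteq> T \<Longrightarrow> ort T \<subseteq> ort S"
  by (auto simp: ort_def)

text \<open>Passing to \<open>ort\<close> reverses inclusions. The domain of a \<open>Fun\<close>
  lies under one reversal; the components of a \<open>Disj\<close> lie under two, as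
  \<open>ort\<close> there restricts a universal quantifier, and are therefore covariant.\<close>

lemma stacks_mono:
  "(\<And>a. occ True a A \<Longrightarrow> v a \<subseteq> w a) \<Longrightarrow> (\<And>a. occ False a A \<Longrightarrow> w a \<subseteq> v a) \<Longrightarrow>
   stacks v A \<subseteq> stacks w A"
proof (induction A arbitrary: v w)
  case (Fun A B)
  have "stacks w A \<subseteq> stacks v A" "stacks v B \<subseteq> stacks w B"
    by (rule Fun.IH; simp add: Fun.prems)+
  then show ?case using ort_anti[of "stacks w A" "stacks v A"] by auto
next
  case (Conj A B)
  have "stacks v A \<subseteq> stacks w A" "stacks v B \<subseteq> stacks w B"
    by (rule Conj.IH; simp add: Conj.prems)+
  then show ?case by auto
next
  case (Disj A B)
  have "stacks v A \<subseteq> stacks w A" "stacks v B \<subseteq> stacks w B"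
    by (rule Disj.IH; simp add: Disj.prems)+
  then show ?case
    using ort_anti[of "stacks v A" "stacks w A"] ort_anti[of "stacks v B" "stacks w B"]
    by (auto simp: subset_iff)
qed auto

lemma Nil_stacks: "[] \<in> stacks v A"
  by (cases A) auto

lemma ort_stacks_SN: "M \<in> ort (stacks v A) \<Longrightarrow> SN M"
  using Nil_stacks[of v A] by (force simp: ort_def)

lemma SN_apps_lift:
  assumes "SN (apps (subst N 0 P) s)"
  shows "SN (apps N (map (lift_elim 0) s))"
proof -
  have "map (sub_elim (case_nat P Var) id_msub) (map (lift_elim 0) s) = s"
    by (simp add: lift0 case_nat_sub_lift sub_id comp_def)
  then have "SN (sub (case_nat P Var) id_msub (apps N (map (lift_elim 0) s)))"
    using assms by (simp add: sub_apps subst_eq_sub del: map_map)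
  then show ?thesis by (rule SN_sub)
qed

lemma Var_ort: "T \<subseteq> Collect SNs \<Longrightarrow> Var x \<in> ort T"
  by (auto simp: ort_def intro: SN_Var_apps)

lemma stacks_SNs: "stacks v A \<subseteq> Collect SNs"
proof (induction A)
  case (Fun A B)
  then show ?case by (auto intro!: SNs_Nil SNs_Arg dest: ort_stacks_SN)
next
  case (Conj A B)
  then show ?case by (auto intro!: SNs_Nil SNs_Proj1 SNs_Proj2)
next
  case (Disj A B)
  show ?case
    \<comment> \<open>Variables are reducible by the induction hypotheses, so each branch has a
      normalizing instance against the rest of the stack, and \<open>SNs_Case\<close>
      applies.\<close>
    using Var_ort[OF Disj.IH(1), of 0] Var_ort[OF Disj.IH(2), of 0]
    by (auto intro!: SNs_Nil SNs_Case SN_apps_lift)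
qed (auto intro: SNs_Nil)

lemma Var_stacks: "Var x \<in> ort (stacks v A)"
  by (rule Var_ort[OF stacks_SNs])

lemma gen_cong_stacks:
  assumes "gen_cong I X F A B" "\<And>i. i \<in> I \<Longrightarrow> v (X i) = stacks v (F i)"
  shows "stacks v A = stacks v B"
  using assms(1)
proof (induction rule: gen_cong.induct)
  case (gen i)
  \<comment> \<open>Adding \<open>[]\<close> and intersecting with the normalizing stacks leaves
    \<open>stacks v (F i)\<close> unchanged, so the equation for \<open>v\<close> carries over to
    the atom.\<close>
  then show ?case using assms(2)[of i] Nil_stacks[of v "F i"] stacks_SNs[of v "F i"] by auto
qed auto

text \<open>The fundamental lemma, for all reducible instances at once: a term variable of type
  \<open>B\<close> receives a reducible term, a \<mu>-variable of type \<not>\<open>B\<close> a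
  stack of \<open>B\<close>.\<close>

lemma adequacy:
  assumes "typing R \<Gamma> \<Delta> M A" "\<And>A B. R A B \<Longrightarrow> stacks v A = stacks v B"
    "\<And>x B. \<Gamma> x = Some B \<Longrightarrow> \<sigma> x \<in> ort (stacks v B)"
    "\<And>b B. \<Delta> b = Some B \<Longrightarrow> snd (\<rho> b) \<in> stacks v B"
  shows "sub \<sigma> \<rho> M \<in> ort (stacks v A)"
  using assms(1,3,4)
proof (induction arbitrary: \<sigma> \<rho> rule: typing.induct)
  case (ax \<Gamma> x A \<Delta>)
  then show ?case by simp
next
  case (impI A \<Gamma> \<Delta> M B)
  have M: "subst (sub (lift_sub \<sigma>) (lift_msub \<rho>) M) 0 N \<in> ort (stacks v B)"
    if "N \<in> ort (stacks v A)" for N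
    unfolding subst_lift_sub using that impI.prems
    by (intro impI.IH) (auto simp: ext_def split: nat.splits)
  show ?case
    unfolding ort_def
  proof (intro CollectI ballI)
    fix s assume s: "s \<in> stacks v (Fun A B)"
    show "SN (apps (sub \<sigma> \<rho> (Lam M)) s)"
    proof (cases s)
      case Nil
      \<comment> \<open>Filling the bound variable with a variable, which is reducible, yields a
        normalizing instance of the body.\<close>
      have "SN (sub (lift_sub \<sigma>) (lift_msub \<rho>) M)"
        using ort_stacks_SN[OF M[OF Var_stacks]] unfolding subst_eq_sub by (rule SN_sub)
      then show ?thesis using Nil by (simp add: SN_Lam)
    next
      case (Cons e t)
      then obtain N where N: "e = Arg N" "N \<in> ort (stacks v A)" "t \<in> stacks v B" using s by auto
      then have "SN (apps (Lam (sub (lift_sub \<sigma>) (lift_msub \<rho>) M)) (Arg N # t))"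
        using M[OF N(2)] stacks_SNs[of v B]
        by (intro SN_Lam_apps) (auto simp: ort_def intro: ort_stacks_SN[of _ v A])
      then show ?thesis using Cons N(1) by simp
    qed
  qed
next
  case (impE \<Gamma> \<Delta> M A B N)
  have "sub \<sigma> \<rho> M \<in> ort (stacks v (Fun A B))" "sub \<sigma> \<rho> N \<in> ort (stacks v A)"
    using impE by auto
  then show ?case by (fastforce simp: ort_def)
next
  case (botI \<Delta> a A \<Gamma> M)
  have "sub \<sigma> \<rho> M \<in> ort (stacks v A)" using botI by auto
  \<comment> \<open>The substitution has already put the stack chosen for \<open>a\<close> behind
    the named term, and a stack of \<open>Bot\<close> can only be empty.\<close>
  then show ?case using botI.prems(2)[OF botI.hyps(1)] by (auto simp: ort_def SN_Nam)
next
  case (botE \<Gamma> A \<Delta> M)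
  show ?case
    unfolding ort_def
  proof (intro CollectI ballI)
    fix s assume s: "s \<in> stacks v A"
    \<comment> \<open>The bound \<mu>-variable is sent to the entire stack \<open>s\<close>; the
      name 0 is an arbitrary choice.\<close>
    have "minst 0 s (sub (mlift_sub \<sigma>) (mlift_msub \<rho>) M) \<in> ort (stacks v Bot)"
      unfolding minst_mlift_sub using s botE.prems
      by (intro botE.IH) (auto simp: ext_def split: nat.splits)
    then have "SN (apps (Mu (sub (mlift_sub \<sigma>) (mlift_msub \<rho>) M)) s)"
      using s stacks_SNs[of v A] by (intro SN_Mu_apps[of 0]) (auto simp: ort_def)
    then show "SN (apps (sub \<sigma> \<rho> (Mu M)) s)" by simp
  qed
next
  case (conjI \<Gamma> \<Delta> M A1 N A2)
  have MN: "sub \<sigma> \<rho> M \<in> ort (stacks v A1)" "sub \<sigma> \<rho> N \<in> ort (stacks v A2)"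
    using conjI by auto
  show ?case
    unfolding ort_def
  proof (intro CollectI ballI)
    fix s assume "s \<in> stacks v (Conj A1 A2)"
    then consider "s = []"
      | t where "s = Proj1 # t" "t \<in> stacks v A1"
      | t where "s = Proj2 # t" "t \<in> stacks v A2"
      by auto
    then show "SN (apps (sub \<sigma> \<rho> (Pair M N)) s)"
    proof cases
      case 1
      then show ?thesis using MN by (auto intro: SN_Pair dest: ort_stacks_SN)
    next
      case 2
      then have "SN (apps (Pair (sub \<sigma> \<rho> M) (sub \<sigma> \<rho> N)) (Proj1 # t))"
        using MN stacks_SNs[of v A1] ort_stacks_SN[OF MN(2)] by (intro SN_Pair_apps) (auto simp: ort_def)
      then show ?thesis using 2 by simp
    next
      case 3
      then have "SN (apps (Pair (sub \<sigma> \<rho> M) (sub \<sigma> \<rho> N)) (Proj2 # t))"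
        using MN stacks_SNs[of v A2] ort_stacks_SN[OF MN(1)] by (intro SN_Pair_apps) (auto simp: ort_def)
      then show ?thesis using 3 by simp
    qed
  qed
next
  case (conjE1 \<Gamma> \<Delta> M A1 A2)
  have "sub \<sigma> \<rho> M \<in> ort (stacks v (Conj A1 A2))" using conjE1 by auto
  moreover have "Proj1 # t \<in> stacks v (Conj A1 A2)" if "t \<in> stacks v A1" for t
    using that by simp
  ultimately have "SN (apps (sub \<sigma> \<rho> M) (Proj1 # t))" if "t \<in> stacks v A1" for t
    unfolding ort_def using that by blast
  then show ?case by (simp add: ort_def)
next
  case (conjE2 \<Gamma> \<Delta> M A1 A2)
  have "sub \<sigma> \<rho> M \<in> ort (stacks v (Conj A1 A2))" using conjE2 by auto
  moreover have "Proj2 # t \<in> stacks v (Conj A1 A2)" if "t \<in> stacks v A2" for t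
    using that by simp
  ultimately have "SN (apps (sub \<sigma> \<rho> M) (Proj2 # t))" if "t \<in> stacks v A2" for t
    unfolding ort_def using that by blast
  then show ?case by (simp add: ort_def)
next
  case (disjI1 \<Gamma> \<Delta> M A1 A2)
  have M: "sub \<sigma> \<rho> M \<in> ort (stacks v A1)" using disjI1 by auto
  show ?case
    unfolding ort_def
  proof (intro CollectI ballI)
    fix s assume s: "s \<in> stacks v (Disj A1 A2)"
    show "SN (apps (sub \<sigma> \<rho> (Inj1 M)) s)"
    proof (cases s)
      case Nil
      then show ?thesis using ort_stacks_SN[OF M] by (simp add: SN_Inj1)
    next
      case (Cons e t)
      then obtain N1 N2 where N: "e = Case N1 N2" "SN (apps (subst N1 0 (sub \<sigma> \<rho> M)) t)"
        using s M by auto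
      moreover have "SNs (Case N1 N2 # t)" using s stacks_SNs Cons N(1) by blast
      ultimately have "SN (apps (Inj1 (sub \<sigma> \<rho> M)) (Case N1 N2 # t))"
        using ort_stacks_SN[OF M] by (intro SN_Inj_apps)
      then show ?thesis using Cons N(1) by simp
    qed
  qed
next
  case (disjI2 \<Gamma> \<Delta> M A2 A1)
  have M: "sub \<sigma> \<rho> M \<in> ort (stacks v A2)" using disjI2 by auto
  show ?case
    unfolding ort_def
  proof (intro CollectI ballI)
    fix s assume s: "s \<in> stacks v (Disj A1 A2)"
    show "SN (apps (sub \<sigma> \<rho> (Inj2 M)) s)"
    proof (cases s)
      case Nil
      then show ?thesis using ort_stacks_SN[OF M] by (simp add: SN_Inj2)
    next
      case (Cons e t)
      then obtain N1 N2 where N: "e = Case N1 N2" "SN (apps (subst N2 0 (sub \<sigma> \<rho> M)) t)"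
        using s M by auto
      moreover have "SNs (Case N1 N2 # t)" using s stacks_SNs Cons N(1) by blast
      ultimately have "SN (apps (Inj2 (sub \<sigma> \<rho> M)) (Case N1 N2 # t))"
        using ort_stacks_SN[OF M] by (intro SN_Inj_apps)
      then show ?thesis using Cons N(1) by simp
    qed
  qed
next
  case (disjE \<Gamma> \<Delta> M A1 A2 N1 C N2)
  have M: "sub \<sigma> \<rho> M \<in> ort (stacks v (Disj A1 A2))" using disjE by auto
  have N1: "subst (sub (lift_sub \<sigma>) (lift_msub \<rho>) N1) 0 P \<in> ort (stacks v C)"
    if "P \<in> ort (stacks v A1)" for P
    unfolding subst_lift_sub using that disjE.prems
    by (intro disjE.IH) (auto simp: ext_def split: nat.splits)
  have N2: "subst (sub (lift_sub \<sigma>) (lift_msub \<rho>) N2) 0 P \<in> ort (stacks v C)"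
    if "P \<in> ort (stacks v A2)" for P
    unfolding subst_lift_sub using that disjE.prems
    by (intro disjE.IH) (auto simp: ext_def split: nat.splits)
  show ?case
    unfolding ort_def
  proof (intro CollectI ballI)
    fix s assume "s \<in> stacks v C"
    \<comment> \<open>The eliminator together with \<open>s\<close> forms one stack of the
      disjunction, so \<open>M\<close> meets both at once.\<close>
    then have "sub_elim \<sigma> \<rho> (Case N1 N2) # s \<in> stacks v (Disj A1 A2)"
      using N1 N2 by (auto simp: ort_def)
    with M have "SN (apps (sub \<sigma> \<rho> M) (sub_elim \<sigma> \<rho> (Case N1 N2) # s))"
      unfolding ort_def by blast
    then show "SN (apps (sub \<sigma> \<rho> (App M (Case N1 N2))) s)" by simp
  qed
next
  case (conv \<Gamma> \<Delta> M A B)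
  then show ?case using assms(2) by metis
qed

text \<open>By \<open>walk_unfold\<close> a negative closed walk would contradict goodness, so
  \<open>solve_equations\<close> applies to the finitely many atoms indexed by
  \<open>J\<close>.\<close>

lemma gen_cong_model:
  fixes X :: "'i \<Rightarrow> 'a"
  assumes "inj_on X I" "good (X ` I) (gen_cong I X F)" "J \<subseteq> I" "finite J"
  shows "\<exists>v. \<forall>i\<in>J. v (X i) = stacks v (F i)"
proof -
  \<comment> \<open>Injectivity of \<open>X\<close> lets the indexed equations be read as a function
    on atoms.\<close>
  define G where "G = F \<circ> inv_into I X"
  have G: "G (X i) = F i" if "i \<in> I" for i
    using assms(1) that by (simp add: G_def)
  have "\<not> walk (X ` J) G a False a" for a
  proof
    assume walk: "walk (X ` J) G a False a"
    have "gen_cong I X F (Atom c) (G c)" if c: "c \<in> X ` J" for c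
    proof -
      obtain i where "i \<in> I" "c = X i" using c assms(3) by blast
      then show ?thesis using gen_cong.gen[of i I X F] G by simp
    qed
    from walk_unfold[OF this walk] obtain A where A: "gen_cong I X F (Atom a) A" "occ False a A"
      by blast
    have "a \<in> X ` I" using walk_in[OF walk] assms(3) by blast
    then have "A \<in> pos a" by (rule assms(2)[unfolded good_def, rule_format, OF _ A(1)])
    then show False using A(2) by (simp add: pos_neg_occ)
  qed
  then have "\<exists>v. (\<forall>a. a \<notin> X ` J \<longrightarrow> v a = {}) \<and> (\<forall>a\<in>X ` J. v a = stacks v (G a))"
    using assms(4) \<open>\<And>a. \<not> walk (X ` J) G a False a\<close>
    by (intro solve_equations[of stacks "X ` J" G] stacks_mono) simp_all
  then obtain v where v: "\<And>a. a \<in> X ` J \<Longrightarrow> v a = stacks v (G a)"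
    by blast
  have "v (X i) = stacks v (F i)" if "i \<in> J" for i
    using v[of "X i"] G[of i] that assms(3) by auto
  then show ?thesis by blast
qed

lemma sn_no_infinite_chain: "sn r x \<Longrightarrow> \<not> (\<exists>f :: nat \<Rightarrow> _. f 0 = x \<and> (\<forall>n. r (f n) (f (Suc n))))"
proof (induction rule: sn.induct)
  case (snI x)
  show ?case
  proof
    assume "\<exists>f :: nat \<Rightarrow> _. f 0 = x \<and> (\<forall>n. r (f n) (f (Suc n)))"
    then obtain f :: "nat \<Rightarrow> _" where f: "f 0 = x" "\<And>n. r (f n) (f (Suc n))" by blast
    have "r x (f 1)" using f(1) f(2)[of 0] by simp
    then show False using snI(2)[of "f 1"] f(2) by (auto dest!: spec[of _ "f \<circ> Suc"])
  qed
qed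

theorem theorem7p8:
  fixes I :: "'i set" and X :: "'i \<Rightarrow> 'a" and F :: "'i \<Rightarrow> 'a ty"
    and \<Gamma> \<Delta> :: "'a ctx" and M :: trm and A :: "'a ty"
  assumes "inj_on X I"
    and "good (X ` I) (gen_cong I X F)"
    and "typing (gen_cong I X F) \<Gamma> \<Delta> M A"
  shows "\<not> (\<exists>f :: nat \<Rightarrow> trm. f 0 = M \<and> (\<forall>n. f n \<triangleright> f (Suc n)))"
proof -
  obtain J where J: "J \<subseteq> I" "finite J" "typing (gen_cong J X F) \<Gamma> \<Delta> M A"
    using typing_finite[OF assms(3)] by blast
  obtain v where v: "\<And>i. i \<in> J \<Longrightarrow> v (X i) = stacks v (F i)"
    using gen_cong_model[OF assms(1,2) J(1,2)] by blast
  \<comment> \<open>The identity substitution is admissible: variables are reducible at every type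
    and the empty stack belongs to every type.\<close>
  have "sub Var id_msub M \<in> ort (stacks v A)"
    by (rule adequacy[OF J(3)]) (auto simp: Var_stacks Nil_stacks dest: gen_cong_stacks[OF _ v])
  then have "SN M" unfolding sub_id by (rule ort_stacks_SN)
  then show ?thesis by (rule sn_no_infinite_chain)
qed

end
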